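(* The equation $S\!E_6(a,b,c,g,p,q,r)$ admits shift operators for each of the shifts $a\to a\pm1$, $b\to b\pm1$, $c\to c\pm1$, $g\to g\pm2$, $p\to p\pm1$, $q\to q\pm1$ and $r\to r\pm1$ (in each shift the other parameters are kept fixed).
   Context: Notation: $\partial=d/dx$, $\theta=x\partial$; $a,b,c,g,p,q,r$ are complex parameters, assumed generic. The operator $E_6(e_1,\dots,e_9)$: put $s=(6-e_1-\cdots-e_9)/3$ and $s_{11}=e_1+e_2+e_3$, $s_{12}=e_4+e_5+e_6$, $s_{13}=e_7+e_8+e_9$, $s_{21}=e_1e_2+e_1e_3+e_2e_3$, $s_{22}=e_4e_5+e_4e_6+e_5e_6$, $s_{23}=e_7e_8+e_7e_9+e_8e_9$, $s_{31}=e_1e_2e_3$, $s_{32}=e_4e_5e_6$, $s_{33}=e_7e_8e_9$. Then $E_6=T_0+T_1\partial+T_2\partial^2+T_3\partial^3$ with $T_0=(\theta+s+2)(\theta+s+1)(\theta+s)(\theta+e_7)(\theta+e_8)(\theta+e_9)$, $T_1=(\theta+s+2)(\theta+s+1)B_1$, $B_1=T_{13}\theta^3+T_{12}\theta^2+T_{11}\theta+T_{10}$, $T_2=(\theta+s+2)B_2$, $B_2=T_{23}\theta^3+T_{22}\theta^2+T_{21}\theta+T_{20}$, $T_3=-(\theta+3-e_1)(\theta+3-e_2)(\theta+3-e_3)$, where $T_{13}=-3$, $T_{23}=3$, $T_{12}=-9+s_{11}-2s_{13}$, $T_{22}=18+s_{13}-2s_{11}$, $T_{11}=-8+(s_{11}^2+2s_{11}s_{13}-s_{12}^2+s_{13}^2)/3+s_{11}-5s_{13}-s_{21}+s_{22}-2s_{23}$,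 $T_{21}=35+(-s_{11}^2-2s_{11}s_{13}+s_{12}^2-s_{13}^2)/3-7s_{11}+5s_{13}+2s_{21}-s_{22}+s_{23}$, $T_{20}=-T_{10}+19+(s_{11}^2s_{13}-s_{11}s_{12}^2+s_{11}s_{13}^2-s_{12}^2s_{13})/9+(s_{13}^3+s_{11}^3-2s_{12}^3)/27+(-2s_{11}^2-4s_{11}s_{13}+s_{11}s_{22}+2s_{12}^2+s_{22}s_{12}-2s_{13}^2+s_{22}s_{13})/3-5s_{11}+4s_{13}+3s_{21}-2s_{22}-s_{31}-s_{32}-s_{33}$, $2T_{10}=(2s_{11}+s_{11}^2+2s_{11}s_{13}-s_{12}^2+s_{13}^2-s_{11}s_{21}+2s_{11}s_{23}+s_{12}s_{22}-2s_{13}s_{21}+2s_{13}s_{22}+s_{13}s_{23}-14s_{13})/3+2(s_{11}^2s_{13}-s_{12}^2s_{13})/9+2(s_{11}^3-s_{12}^3)/27-5-s_{21}+s_{31}+s_{22}-s_{32}-5s_{23}-3s_{33}$. The operator $S\!E_6(a,b,c,g,p,q,r)$ is $E_6(e_1,\dots,e_9)$ with (writing $\delta=a+b+c$) $e_1=p+r+1$, $e_2=a+c+p+r+2$, $e_3=2a+2c+g+p+r+3$, $e_4=q+r+1$, $e_5=b+c+q+r+2$, $e_6=2b+2c+g+q+r+3$, $e_7=-2c-(p+q+r)-1$, $e_8=-\delta-c-(p+q+r+g)-2$, $e_9=-2\delta-(p+q+r+g)-3$; then $s=-r$. Shift operator: let $E(\mathbf a)\in\mathbb C(x)[\partial]$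 be an operator of order $n$ depending on parameters $\mathbf a$ and let $\mathbf a\to sh(\mathbf a)$ be a shift of the parameters. A shift operator of $E$ for this shift is a non-zero operator $P\in\mathbb C(x)[\partial]$ of order lower than $n$ that sends the solution space of $E(\mathbf a)$ into that of $E(sh(\mathbf a))$; equivalently, there is $Q\in\mathbb C(x)[\partial]$ with $E(sh(\mathbf a))\circ P=Q\circ E(\mathbf a)$. *)

theory Defs
  imports
    "HOL-Computational_Algebra.Computational_Algebra"
    "HOL-Library.Poly_Mapping"
begin

type_synonym ratfun = "complex poly fract"

definition ratfun_const :: "complex \<Rightarrow> ratfun"
  where "ratfun_const c = Fract [:c:] 1"

definition ratfun_X :: ratfun
  where "ratfun_X = Fract [:0, 1:] 1"

text \<open>
  The quotient rule, applied to some representative; by \<open>ratfun_deriv_Fract\<close> below, every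
  representative gives the same result.
\<close>

definition ratfun_deriv :: "ratfun \<Rightarrow> ratfun"
  where "ratfun_deriv f =
    (case SOME (u, v). v \<noteq> 0 \<and> f = Fract u v of
       (u, v) \<Rightarrow> Fract (pderiv u * v - u * pderiv v) (v * v))"

lemma ratfun_deriv_Fract:
  assumes "v \<noteq> 0"
  shows "ratfun_deriv (Fract u v) = Fract (pderiv u * v - u * pderiv v) (v * v)"
proof -
  define w where "w = (SOME (u', v'). v' \<noteq> 0 \<and> Fract u v = Fract u' v')"
  obtain u' v' where w: "w = (u', v')"
    by fastforce
  have "case w of (u', v') \<Rightarrow> v' \<noteq> 0 \<and> Fract u v = Fract u' v'"
    unfolding w_def by (rule someI[of _ "(u, v)"]) (simp add: assms)
  then have nz: "v' \<noteq> 0" and "Fract u v = Fract u' v'"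
    by (simp_all add: w)
  then have eq: "u * v' = u' * v"
    using assms by (simp add: eq_fract)
  have q: "ratfun_deriv (Fract u v) = Fract (pderiv u' * v' - u' * pderiv v') (v' * v')"
    using w by (simp add: ratfun_deriv_def w_def)
  have d: "pderiv u * v' + u * pderiv v' = pderiv u' * v + u' * pderiv v"
    using arg_cong[OF eq, of pderiv] by (simp add: pderiv_mult algebra_simps)
  have "(pderiv u' * v' - u' * pderiv v') * (v * v) = (pderiv u * v - u * pderiv v) * (v' * v')"
    using eq d by algebra
  then show ?thesis
    using assms nz by (simp add: q eq_fract)
qed

lemma ratfun_deriv_add: "ratfun_deriv (f + g) = ratfun_deriv f + ratfun_deriv g"
proof (cases f; cases g)
  fix u v u' v' :: "complex poly"
  assume *: "f = Fract u v" "v \<noteq> 0" "g = Fract u' v'" "v' \<noteq> 0"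
  show ?thesis
    using * by (simp add: ratfun_deriv_Fract eq_fract pderiv_add pderiv_mult algebra_simps)
qed

lemma ratfun_deriv_mult: "ratfun_deriv (f * g) = f * ratfun_deriv g + ratfun_deriv f * g"
proof (cases f; cases g)
  fix u v u' v' :: "complex poly"
  assume *: "f = Fract u v" "v \<noteq> 0" "g = Fract u' v'" "v' \<noteq> 0"
  show ?thesis
    using * by (simp add: ratfun_deriv_Fract eq_fract pderiv_mult algebra_simps)
qed

lemma ratfun_deriv_0 [simp]: "ratfun_deriv 0 = 0"
  using ratfun_deriv_Fract[of 1 0] by (simp add: fract_collapse)

lemma ratfun_deriv_1 [simp]: "ratfun_deriv 1 = 0"
  using ratfun_deriv_Fract[of 1 1] by (simp add: fract_collapse)

lemma ratfun_deriv_const [simp]: "ratfun_deriv (ratfun_const c) = 0"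
  by (simp add: ratfun_const_def ratfun_deriv_Fract fract_collapse pderiv_pCons)

lemma ratfun_deriv_X [simp]: "ratfun_deriv ratfun_X = 1"
  by (simp add: ratfun_X_def ratfun_deriv_Fract One_fract_def pderiv_pCons eq_fract)

text \<open>
  The polynomial with coefficients \<open>f\<^sub>0, \<dots>, f\<^sub>n\<close> stands for
  \<open>f\<^sub>0 + f\<^sub>1 \<partial> + \<dots> + f\<^sub>n \<partial>\<^sup>n\<close>. The map \<open>ore_step\<close> is left composition with
  \<open>\<partial>\<close>, that is, \<open>\<partial> \<circ> f \<partial>\<^sup>i = f \<partial>\<^sup>i\<^sup>+\<^sup>1 + f' \<partial>\<^sup>i\<close>, and \<open>ore_mult\<close> is composition.
\<close>

definition ore_step :: "ratfun poly \<Rightarrow> ratfun poly"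
  where "ore_step B = pCons 0 B + map_poly ratfun_deriv B"

definition ore_mult :: "ratfun poly \<Rightarrow> ratfun poly \<Rightarrow> ratfun poly"
  where "ore_mult A B = (\<Sum>i\<le>degree A. smult (coeff A i) ((ore_step ^^ i) B))"

lemma coeff_ore_step:
  "coeff (ore_step B) n = (case n of 0 \<Rightarrow> 0 | Suc m \<Rightarrow> coeff B m) + ratfun_deriv (coeff B n)"
  by (simp add: ore_step_def coeff_map_poly coeff_pCons)

lemma ore_step_0 [simp]: "ore_step 0 = 0"
  by (simp add: ore_step_def)

lemma ore_step_add: "ore_step (A + B) = ore_step A + ore_step B"
  by (rule poly_eqI) (simp add: coeff_ore_step ratfun_deriv_add split: nat.split)

lemma ore_step_smult: "ore_step (smult f B) = smult f (ore_step B) + smult (ratfun_deriv f) B"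
  by (rule poly_eqI) (simp add: coeff_ore_step ratfun_deriv_mult algebra_simps split: nat.split)

lemma ore_step_sum: "ore_step (sum h I) = (\<Sum>i\<in>I. ore_step (h i))"
  by (induction I rule: infinite_finite_induct) (simp_all add: ore_step_add)

lemma ore_step_pow_0 [simp]: "(ore_step ^^ i) 0 = 0"
  by (induction i) simp_all

lemma ore_step_pow_add: "(ore_step ^^ i) (A + B) = (ore_step ^^ i) A + (ore_step ^^ i) B"
  by (induction i) (simp_all add: ore_step_add)

lemma ore_mult_bound:
  assumes "degree A \<le> n"
  shows "ore_mult A B = (\<Sum>i\<le>n. smult (coeff A i) ((ore_step ^^ i) B))"
  unfolding ore_mult_def using assms
  by (intro sum.mono_neutral_left) (auto simp: coeff_eq_0)

lemma ore_mult_add_left: "ore_mult (A + B) C = ore_mult A C + ore_mult B C"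
proof -
  define n where "n = max (degree A) (degree B)"
  have "degree A \<le> n" "degree B \<le> n" "degree (A + B) \<le> n"
    by (auto simp: n_def intro: degree_add_le)
  then show ?thesis
    by (simp add: ore_mult_bound[of _ n] smult_add_left sum.distrib)
qed

lemma ore_mult_add_right: "ore_mult A (B + C) = ore_mult A B + ore_mult A C"
  by (simp add: ore_mult_def ore_step_pow_add smult_add_right sum.distrib)

lemma ore_mult_0_left [simp]: "ore_mult 0 B = 0"
  by (simp add: ore_mult_def)

lemma ore_mult_0_right [simp]: "ore_mult A 0 = 0"
  by (simp add: ore_mult_def)

lemma ore_mult_smult_left: "ore_mult (smult f A) B = smult f (ore_mult A B)"
proof -
  have "smult f (sum h I) = (\<Sum>i\<in>I. smult f (h i))" for h :: "nat \<Rightarrow> ratfun poly" and I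
    by (induction I rule: infinite_finite_induct) (simp_all add: smult_add_right)
  then show ?thesis
    by (simp add: ore_mult_bound[of "smult f A" "degree A"] degree_smult_le ore_mult_def)
qed

lemma ore_mult_sum_left: "ore_mult (sum h I) B = (\<Sum>i\<in>I. ore_mult (h i) B)"
  by (induction I rule: infinite_finite_induct) (simp_all add: ore_mult_add_left)

lemma ore_mult_ore_step: "ore_mult (ore_step A) B = ore_step (ore_mult A B)"
proof -
  have 1: "ore_mult (pCons 0 A) B = (\<Sum>i\<le>degree A. smult (coeff A i) ((ore_step ^^ Suc i) B))"
    by (subst ore_mult_bound[of _ "Suc (degree A)"])
       (simp_all only: degree_pCons_le sum.atMost_Suc_shift coeff_pCons_0 coeff_pCons_Suc smult_0_left add_0_left)
  have 2: "ore_mult (map_poly ratfun_deriv A) B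
      = (\<Sum>i\<le>degree A. smult (ratfun_deriv (coeff A i)) ((ore_step ^^ i) B))"
    by (subst ore_mult_bound[of _ "degree A"]) (auto simp: map_poly_degree_leq coeff_map_poly)
  have "ore_mult (ore_step A) B = ore_mult (pCons 0 A) B + ore_mult (map_poly ratfun_deriv A) B"
    by (simp add: ore_step_def ore_mult_add_left)
  also have "\<dots> = ore_step (ore_mult A B)"
    unfolding 1 2 by (simp add: ore_mult_def ore_step_sum ore_step_smult sum.distrib)
  finally show ?thesis .
qed

lemma ore_mult_ore_step_pow: "ore_mult ((ore_step ^^ i) A) B = (ore_step ^^ i) (ore_mult A B)"
  by (induction i) (simp_all add: ore_mult_ore_step)

lemma ore_mult_assoc: "ore_mult (ore_mult A B) C = ore_mult A (ore_mult B C)"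
  by (simp add: ore_mult_def[of A] ore_mult_sum_left ore_mult_smult_left ore_mult_ore_step_pow)

lemma ore_mult_1_left [simp]: "ore_mult 1 B = B"
  by (simp add: ore_mult_def)

lemma ore_step_pow_1: "(ore_step ^^ i) 1 = monom 1 i"
proof (induction i)
  case (Suc i)
  have "ore_step (monom 1 i) = monom 1 (Suc i)"
    by (rule poly_eqI) (auto simp: coeff_ore_step split: nat.split)
  with Suc show ?case by simp
qed (simp add: monom_0)

lemma ore_mult_1_right [simp]: "ore_mult A 1 = A"
  by (simp add: ore_mult_def ore_step_pow_1 smult_monom poly_as_sum_of_monoms)

typedef diffop = "UNIV :: ratfun poly set"
  morphisms diffop_coeffs Diffop ..

setup_lifting type_definition_diffop

instantiation diffop :: ring_1
begin

lift_definition zero_diffop :: diffop is 0 .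
lift_definition one_diffop :: diffop is 1 .
lift_definition plus_diffop :: "diffop \<Rightarrow> diffop \<Rightarrow> diffop" is "(+)" .
lift_definition minus_diffop :: "diffop \<Rightarrow> diffop \<Rightarrow> diffop" is "(-)" .
lift_definition uminus_diffop :: "diffop \<Rightarrow> diffop" is uminus .
lift_definition times_diffop :: "diffop \<Rightarrow> diffop \<Rightarrow> diffop" is ore_mult .

instance
  by standard
     (transfer; simp add: ore_mult_assoc ore_mult_add_left ore_mult_add_right)+

end

definition diffop_order :: "diffop \<Rightarrow> nat"
  where "diffop_order A = degree (diffop_coeffs A)"

definition mult_op :: "ratfun \<Rightarrow> diffop"
  where "mult_op f = Diffop [:f:]"

definition ddx :: diffop
  where "ddx = Diffop [:0, 1:]"

lemma mult_op_rep: "diffop_coeffs (mult_op f) = [:f:]"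
  by (simp add: mult_op_def Diffop_inverse)

lemma ddx_rep: "diffop_coeffs ddx = [:0, 1:]"
  by (simp add: ddx_def Diffop_inverse)

abbreviation cst :: "complex \<Rightarrow> diffop"
  where "cst c \<equiv> mult_op (ratfun_const c)"

definition theta :: diffop
  where "theta = mult_op ratfun_X * ddx"

lemma ddx_mult_op: "ddx * mult_op f = mult_op f * ddx + mult_op (ratfun_deriv f)"
proof (rule diffop_coeffs_inject[THEN iffD1])
  show "diffop_coeffs (ddx * mult_op f) = diffop_coeffs (mult_op f * ddx + mult_op (ratfun_deriv f))"
    unfolding times_diffop.rep_eq plus_diffop.rep_eq mult_op_rep ddx_rep
    by (simp add: ore_mult_def ore_step_def map_poly_pCons)
qed

lemma mult_op_mult: "mult_op (f * g) = mult_op f * mult_op g"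
proof (rule diffop_coeffs_inject[THEN iffD1])
  show "diffop_coeffs (mult_op (f * g)) = diffop_coeffs (mult_op f * mult_op g)"
    unfolding times_diffop.rep_eq mult_op_rep by (simp add: ore_mult_def)
qed

definition E6 ::
  "complex \<Rightarrow> complex \<Rightarrow> complex \<Rightarrow> complex \<Rightarrow> complex \<Rightarrow> complex \<Rightarrow> complex \<Rightarrow> complex \<Rightarrow> complex \<Rightarrow> diffop"
where
  "E6 e1 e2 e3 e4 e5 e6 e7 e8 e9 =
   (let s = (6 - (e1 + e2 + e3 + e4 + e5 + e6 + e7 + e8 + e9)) / 3;
        s11 = e1 + e2 + e3;
        s12 = e4 + e5 + e6;
        s13 = e7 + e8 + e9;
        s21 = e1 * e2 + e1 * e3 + e2 * e3;
        s22 = e4 * e5 + e4 * e6 + e5 * e6;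
        s23 = e7 * e8 + e7 * e9 + e8 * e9;
        s31 = e1 * e2 * e3;
        s32 = e4 * e5 * e6;
        s33 = e7 * e8 * e9;
        T13 = - 3;
        T23 = 3;
        T12 = - 9 + s11 - 2 * s13;
        T22 = 18 + s13 - 2 * s11;
        T11 = - 8 + (s11^2 + 2 * s11 * s13 - s12^2 + s13^2) / 3
              + s11 - 5 * s13 - s21 + s22 - 2 * s23;
        T21 = 35 + (- (s11^2) - 2 * s11 * s13 + s12^2 - s13^2) / 3
              - 7 * s11 + 5 * s13 + 2 * s21 - s22 + s23;
        T10 = ((2 * s11 + s11^2 + 2 * s11 * s13 - s12^2 + s13^2 - s11 * s21 + 2 * s11 * s23
                + s12 * s22 - 2 * s13 * s21 + 2 * s13 * s22 + s13 * s23 - 14 * s13) / 3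
               + 2 * (s11^2 * s13 - s12^2 * s13) / 9
               + 2 * (s11^3 - s12^3) / 27
               - 5 - s21 + s31 + s22 - s32 - 5 * s23 - 3 * s33) / 2;
        T20 = - T10 + 19
              + (s11^2 * s13 - s11 * s12^2 + s11 * s13^2 - s12^2 * s13) / 9
              + (s13^3 + s11^3 - 2 * s12^3) / 27
              + (- 2 * s11^2 - 4 * s11 * s13 + s11 * s22 + 2 * s12^2 + s22 * s12
                 - 2 * s13^2 + s22 * s13) / 3
              - 5 * s11 + 4 * s13 + 3 * s21 - 2 * s22 - s31 - s32 - s33;
        B1 = cst T13 * theta^3 + cst T12 * theta^2 + cst T11 * theta + cst T10;
        B2 = cst T23 * theta^3 + cst T22 * theta^2 + cst T21 * theta + cst T20;
        T0 = (theta + cst (s + 2)) * (theta + cst (s + 1)) * (theta + cst s)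
             * (theta + cst e7) * (theta + cst e8) * (theta + cst e9);
        T1 = (theta + cst (s + 2)) * (theta + cst (s + 1)) * B1;
        T2 = (theta + cst (s + 2)) * B2;
        T3 = - ((theta + cst (3 - e1)) * (theta + cst (3 - e2)) * (theta + cst (3 - e3)))
    in T0 + T1 * ddx + T2 * ddx^2 + T3 * ddx^3)"

datatype param = par_a | par_b | par_c | par_g | par_p | par_q | par_r

definition SE6 :: "(param \<Rightarrow> complex) \<Rightarrow> diffop"
where
  "SE6 v =
   (let a = v par_a; b = v par_b; c = v par_c; g = v par_g;
        p = v par_p; q = v par_q; r = v par_r; \<delta> = a + b + c
    in E6 (p + r + 1)
          (a + c + p + r + 2)
          (2 * a + 2 * c + g + p + r + 3)
          (q + r + 1)
          (b + c + q + r + 2)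
          (2 * b + 2 * c + g + q + r + 3)
          (- 2 * c - (p + q + r) - 1)
          (- \<delta> - c - (p + q + r + g) - 2)
          (- 2 * \<delta> - (p + q + r + g) - 3))"

text \<open>
  The condition that \<open>P\<close> maps solutions of \<open>E v\<close> to solutions of \<open>E (sh v)\<close> is expressed by
  right divisibility of \<open>E (sh v) \<circ> P\<close> by \<open>E v\<close>: the remainder of right division has order
  smaller than that of \<open>E v\<close> and kills all its solutions, so it vanishes.
\<close>

definition is_shift_operator ::
  "('v \<Rightarrow> diffop) \<Rightarrow> ('v \<Rightarrow> 'v) \<Rightarrow> 'v \<Rightarrow> diffop \<Rightarrow> bool"
where
  "is_shift_operator E sh v P \<longleftrightarrow>
     P \<noteq> 0 \<and> diffop_order P < diffop_order (E v) \<and> (\<exists>Q. E (sh v) * P = Q * E v)"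

text \<open>
  Polynomials in the indeterminates \<open>'i\<close> are finitely supported maps from monomials
  (finitely supported exponent vectors) to coefficients.
\<close>

definition mpoly_eval :: "(('i \<Rightarrow>\<^sub>0 nat) \<Rightarrow>\<^sub>0 complex) \<Rightarrow> ('i \<Rightarrow> complex) \<Rightarrow> complex"
where
  "mpoly_eval F v =
     (\<Sum>m\<in>Poly_Mapping.keys F.
        Poly_Mapping.lookup F m * (\<Prod>i\<in>Poly_Mapping.keys m. v i ^ Poly_Mapping.lookup m i))"

text \<open>
  A property holds for generic parameters if it holds off a proper algebraic hypersurface.
\<close>

definition generically :: "(('i \<Rightarrow> complex) \<Rightarrow> bool) \<Rightarrow> bool"
where
  "generically \<Phi> \<longleftrightarrow>
     (\<exists>F :: ('i \<Rightarrow>\<^sub>0 nat) \<Rightarrow>\<^sub>0 complex. F \<noteq> 0 \<and> (\<forall>v. mpoly_eval F v \<noteq> 0 \<longrightarrow> \<Phi> v))"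

definition shift_param :: "'i \<Rightarrow> complex \<Rightarrow> ('i \<Rightarrow> complex) \<Rightarrow> 'i \<Rightarrow> complex"
  where "shift_param i k v = v(i := v i + k)"

definition admits_shift_operator ::
  "(('i \<Rightarrow> complex) \<Rightarrow> diffop) \<Rightarrow> (('i \<Rightarrow> complex) \<Rightarrow> ('i \<Rightarrow> complex)) \<Rightarrow> bool"
where
  "admits_shift_operator E sh \<longleftrightarrow> generically (\<lambda>v. \<exists>P. is_shift_operator E sh v P)"

end

theory Submission
  imports Defs
begin

text \<open>
  Before middle convolution, \<open>SE6\<close> is an equation of order three in \<open>w = \<theta> - p - r\<close>, and the middle
  convolution is linear in the coefficient polynomials: writing an operator as
  \<open>\<Sum>\<^sub>k F\<^sub>k(w) (\<theta> - r + k) \<dots> (\<theta> - r + N - 1) \<partial>\<^sup>k\<close>, an intertwining relation between two such operators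
  becomes a family of polynomial identities among the \<open>F\<^sub>k\<close> in which \<open>r\<close> no longer occurs. In this form
  the parameters \<open>a\<close>, \<open>b\<close>, \<open>c\<close> and \<open>g\<close> are shifted by operators with quadratic coefficients, at the cost
  of auxiliary integer shifts of \<open>p\<close>, \<open>q\<close> and \<open>r\<close>.
  The shifts of \<open>p\<close>, \<open>q\<close> and \<open>r\<close> come from the first-order operators \<open>\<theta> - r\<close>, \<open>\<theta> - r - \<partial>\<close> and \<open>\<partial>\<close>, which
  are generically invertible modulo the equation. Composing with their inverses removes the auxiliary
  shifts without making the composite vanish modulo the equation, and right division brings the
  order below six.
\<close>

subsection \<open>Orders and right division\<close>

text \<open>An intertwining relation is a linear problem; the obstacle is to know that its solution
  does not vanish modulo the equation. Nonzero morphisms may compose to zero, so every auxiliary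
  shift has to be an isomorphism with its inverse at hand. With y for 1/x, the argument F of
  \<open>conv_op\<close> stands for x^N F(y) before convolution. The three first-order operators are
  then the convolutions of multiplication by x, x - 1 and 1, with kernels spanned by x^r, (x - 1)^r
  and 1. Right division of \<open>SE6\<close> leaves a constant for \<partial> and a constant times
  \<partial>^3 for the other two; these constants are products of linear forms, the origin of the
  first twelve factors of \<open>resonance\<close>. The operators with quadratic coefficients have
  order at most d + 2 if r drops by d. This is below six except for g -> g - 2, where d = 4; there a
  term x^2 in the top coefficient distinguishes them from multiples of \<open>SE6\<close>, whose
  leading coefficient is x^3 (x - 1)^3.\<close>

lemma diffop_eqI: "(\<And>n. coeff (diffop_coeffs A) n = coeff (diffop_coeffs B) n) \<Longrightarrow> A = B"
  by (metis diffop_coeffs_inject poly_eqI)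

lemma diffop_coeffs_arith [simp]:
  "diffop_coeffs 0 = 0" "diffop_coeffs 1 = 1"
  "diffop_coeffs (A + B) = diffop_coeffs A + diffop_coeffs B"
  "diffop_coeffs (A - B) = diffop_coeffs A - diffop_coeffs B"
  "diffop_coeffs (- A) = - diffop_coeffs A"
  by (simp_all add: zero_diffop.rep_eq one_diffop.rep_eq plus_diffop.rep_eq
      minus_diffop.rep_eq uminus_diffop.rep_eq)

lemma diffop_coeffs_sum: "diffop_coeffs (sum h I) = (\<Sum>i\<in>I. diffop_coeffs (h i))"
  by (induction I rule: infinite_finite_induct) simp_all

text \<open>Composition with \<partial> differentiates coefficients only in lower orders and moves
  the leading one up unchanged. Hence top coefficients of operators multiply.\<close>

lemma degree_ore_step_pow:
  assumes "degree B \<le> n"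
  shows "degree ((ore_step ^^ i) B) \<le> i + n \<and> coeff ((ore_step ^^ i) B) (i + n) = coeff B n"
proof (induction i)
  case (Suc i)
  let ?C = "(ore_step ^^ i) B"
  have z: "coeff ?C m = 0" if "m > i + n" for m
    using Suc that by (meson coeff_eq_0 le_less_trans)
  have "coeff (ore_step ?C) m = 0" if "m > Suc i + n" for m
    using that z[of m] z[of "m - 1"] by (cases m) (auto simp: coeff_ore_step)
  then show ?case
    using Suc z[of "Suc (i + n)"] by (auto simp: coeff_ore_step intro!: degree_le)
qed (use assms in simp)

lemma
  assumes "diffop_order A \<le> m" "diffop_order B \<le> n"
  shows diffop_order_times_le: "diffop_order (A * B) \<le> m + n"
    and coeff_times_top:
      "coeff (diffop_coeffs (A * B)) (m + n) = coeff (diffop_coeffs A) m * coeff (diffop_coeffs B) n"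
proof -
  let ?a = "diffop_coeffs A" and ?b = "diffop_coeffs B"
  have d: "degree ?a \<le> m" "degree ?b \<le> n"
    using assms by (simp_all add: diffop_order_def)
  have eq: "diffop_coeffs (A * B) = (\<Sum>i\<le>m. smult (coeff ?a i) ((ore_step ^^ i) ?b))"
    by (simp add: times_diffop.rep_eq ore_mult_bound[OF d(1)])
  have z: "coeff ((ore_step ^^ i) ?b) k = 0" if "i + n < k" for i k
    using degree_ore_step_pow[OF d(2), of i] that by (meson coeff_eq_0 le_less_trans)
  show "diffop_order (A * B) \<le> m + n"
    unfolding diffop_order_def eq using z by (intro degree_le) (auto simp: coeff_sum intro!: sum.neutral)
  have "coeff (diffop_coeffs (A * B)) (m + n)
      = (\<Sum>i\<le>m. if i = m then coeff ?a m * coeff ?b n else 0)"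
    unfolding eq coeff_sum using z degree_ore_step_pow[OF d(2)]
    by (intro sum.cong) auto
  then show "coeff (diffop_coeffs (A * B)) (m + n) = coeff ?a m * coeff ?b n"
    by simp
qed

lemma lead_coeff_diffop_nonzero:
  "A \<noteq> 0 \<Longrightarrow> coeff (diffop_coeffs A) (diffop_order A) \<noteq> 0"
  by (metis diffop_coeffs_arith(1) diffop_coeffs_inject diffop_order_def leading_coeff_0_iff)

lemma diffop_order_eqI:
  "diffop_order A \<le> n \<Longrightarrow> coeff (diffop_coeffs A) n \<noteq> 0 \<Longrightarrow> diffop_order A = n"
  by (simp add: diffop_order_def le_antisym le_degree)

lemma
  assumes "A \<noteq> 0" "B \<noteq> 0"
  shows diffop_order_times: "diffop_order (A * B) = diffop_order A + diffop_order B"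
    and diffop_times_nonzero: "A * B \<noteq> 0"
proof -
  have nz: "coeff (diffop_coeffs (A * B)) (diffop_order A + diffop_order B) \<noteq> 0"
    using assms by (simp add: coeff_times_top lead_coeff_diffop_nonzero)
  then show "diffop_order (A * B) = diffop_order A + diffop_order B"
    by (intro diffop_order_eqI diffop_order_times_le) auto
  show "A * B \<noteq> 0"
    using nz by auto
qed

lemma diffop_order_1 [simp]: "diffop_order 1 = 0"
  by (simp add: diffop_order_def)

lemma diffop_order_mult_op [simp]: "diffop_order (mult_op f) = 0"
  by (simp add: diffop_order_def mult_op_rep)

lemma diffop_order_ddx_pow: "diffop_order (ddx ^ k) \<le> k"
  and coeff_ddx_pow: "coeff (diffop_coeffs (ddx ^ k)) k = 1"
proof (induction k)
  case (Suc k)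
  have 1: "diffop_order ddx \<le> 1" by (simp add: diffop_order_def ddx_rep)
  {
    case 1
    show ?case using diffop_order_times_le[OF \<open>diffop_order ddx \<le> 1\<close> Suc(1)] by simp
  next
    case 2
    show ?case using coeff_times_top[OF \<open>diffop_order ddx \<le> 1\<close> Suc(1)] Suc(2)
      by (simp add: ddx_rep)
  }
qed simp_all

lemma mult_op_1 [simp]: "mult_op 1 = 1"
  by (rule diffop_eqI) (simp add: mult_op_rep one_pCons)

lemma mult_op_0 [simp]: "mult_op 0 = 0"
  by (rule diffop_eqI) (simp add: mult_op_rep)

lemma mult_op_add: "mult_op (f + g) = mult_op f + mult_op g"
  by (rule diffop_eqI) (simp add: mult_op_rep)

lemma coeff_mult_op_times:
  "coeff (diffop_coeffs (mult_op f * A)) n = f * coeff (diffop_coeffs A) n"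
  by (simp add: times_diffop.rep_eq mult_op_rep ore_mult_def)

lemma diffop_order_0E:
  assumes "diffop_order A = 0"
  obtains f where "A = mult_op f"
proof -
  have "A = mult_op (coeff (diffop_coeffs A) 0)"
    using assms by (intro diffop_eqI)
      (simp add: mult_op_rep diffop_order_def coeff_pCons coeff_eq_0 split: nat.split)
  then show ?thesis by (rule that)
qed

lemma diffop_right_division:
  assumes "E \<noteq> 0" "diffop_order E > 0"
  obtains Q R where "A = Q * E + R" "diffop_order R < diffop_order E"
proof -
  have "\<exists>Q R. A = Q * E + R \<and> diffop_order R < diffop_order E"
  proof (induction "diffop_order A" arbitrary: A rule: less_induct)
    case less
    let ?m = "diffop_order A" and ?n = "diffop_order E"
    show ?case
    proof (cases "?m < ?n")
      case False
      define f where "f = coeff (diffop_coeffs A) ?m / coeff (diffop_coeffs E) ?n"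
      define M where "M = mult_op f * ddx ^ (?m - ?n)"
      have M: "diffop_order M \<le> ?m - ?n" "coeff (diffop_coeffs M) (?m - ?n) = f"
        using diffop_order_times_le[OF _ diffop_order_ddx_pow, of "mult_op f" 0]
        by (simp_all add: M_def coeff_mult_op_times coeff_ddx_pow)
      let ?A = "A - M * E"
      have le: "diffop_order (M * E) \<le> ?m"
        using diffop_order_times_le[OF M(1) order_refl, of E] False by simp
      have top: "coeff (diffop_coeffs ?A) ?m = 0"
        using coeff_times_top[OF M(1) order_refl, of E] M(2) False lead_coeff_diffop_nonzero[OF assms(1)]
        by (simp add: f_def)
      have "diffop_order ?A \<le> ?m"
        using le by (simp add: diffop_order_def degree_diff_le)
      then have "diffop_order ?A < ?m \<or> ?A = 0"
        using top lead_coeff_diffop_nonzero[of ?A] by (metis le_neq_implies_less)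
      \<comment> \<open>The zero operator has order 0, so a zero remainder meets the bound only
        because \<open>E\<close> has positive order.\<close>
      moreover have "\<exists>Q R. ?A = Q * E + R \<and> diffop_order R < ?n" if "?A = 0"
        using that assms(2) by (intro exI[of _ 0]) (simp add: diffop_order_def)
      ultimately obtain Q R where "?A = Q * E + R" "diffop_order R < ?n"
        using less by blast
      then show ?thesis
        by (intro exI[of _ "Q + M"] exI[of _ R]) (simp add: algebra_simps)
    qed (metis add_0 mult_zero_left)
  qed
  then show ?thesis using that by blast
qed

subsection \<open>Morphisms between differential equations\<close>

text \<open>Ore's similarity: right multiplication by \<open>P\<close> and \<open>X\<close> gives
  inverse isomorphisms between the left modules D/DF and D/DE.\<close>

definition diffop_equiv :: "diffop \<Rightarrow> diffop \<Rightarrow> bool" where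
  "diffop_equiv E F \<longleftrightarrow> (\<exists>P X Q Y S T. F * P = Q * E \<and> E * X = Y * F \<and>
     X * P = 1 + S * E \<and> P * X = 1 + T * F)"

text \<open>A nonzero homomorphism D/DF -> D/DE. Without the order bound of
  \<open>is_shift_operator\<close> the notion is stable under composition with equivalences.\<close>

definition has_morphism :: "diffop \<Rightarrow> diffop \<Rightarrow> bool" where
  "has_morphism E F \<longleftrightarrow> (\<exists>P Q. F * P = Q * E \<and> (\<forall>S. P \<noteq> S * E))"

lemma diffop_equiv_refl: "diffop_equiv E E"
  unfolding diffop_equiv_def
  by (rule exI[of _ 1], rule exI[of _ 1], rule exI[of _ 1], rule exI[of _ 1], rule exI[of _ 0], rule exI[of _ 0]) simp

lemma diffop_equiv_sym: "diffop_equiv E F \<Longrightarrow> diffop_equiv F E"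
  unfolding diffop_equiv_def by blast

lemma diffop_equiv_trans:
  assumes "diffop_equiv E F" "diffop_equiv F G"
  shows "diffop_equiv E G"
proof -
  from assms(1) obtain P X Q Y S T where 1: "F * P = Q * E" "E * X = Y * F"
    "X * P = 1 + S * E" "P * X = 1 + T * F" by (auto simp: diffop_equiv_def)
  from assms(2) obtain P' X' Q' Y' S' T' where 2: "G * P' = Q' * F" "F * X' = Y' * G"
    "X' * P' = 1 + S' * F" "P' * X' = 1 + T' * G" by (auto simp: diffop_equiv_def)
  have "G * (P' * P) = (Q' * Q) * E"
    by (metis 1(1) 2(1) mult.assoc)
  moreover have "E * (X * X') = (Y * Y') * G"
    by (metis 1(2) 2(2) mult.assoc)
  moreover have "(X * X') * (P' * P) = 1 + (S + X * S' * Q) * E"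
  proof -
    have "(X * X') * (P' * P) = X * (X' * P') * P" by (simp add: mult.assoc)
    also have "\<dots> = X * P + X * S' * (F * P)" by (simp add: 2(3) algebra_simps)
    finally show ?thesis by (simp add: 1(1,3) algebra_simps)
  qed
  moreover have "(P' * P) * (X * X') = 1 + (T' + P' * T * Y') * G"
  proof -
    have "(P' * P) * (X * X') = P' * (P * X) * X'" by (simp add: mult.assoc)
    also have "\<dots> = P' * X' + P' * T * (F * X')" by (simp add: 1(4) algebra_simps)
    finally show ?thesis by (simp add: 2(2,4) algebra_simps)
  qed
  ultimately show ?thesis unfolding diffop_equiv_def by blast
qed

text \<open>The inverse of \<open>P'\<close> modulo \<open>F\<close> detects vanishing: if
  \<open>P' * P\<close> were a left multiple of \<open>E\<close>, applying \<open>X'\<close> would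
  make \<open>P\<close> one as well.\<close>

lemma has_morphism_equiv_right:
  assumes "has_morphism E F" "diffop_equiv F G"
  shows "has_morphism E G"
proof -
  from assms(1) obtain P Q where 1: "F * P = Q * E" "\<And>S. P \<noteq> S * E"
    by (auto simp: has_morphism_def)
  from assms(2) obtain P' X' Q' S' where 2: "G * P' = Q' * F" "X' * P' = 1 + S' * F"
    by (auto simp: diffop_equiv_def)
  have "G * (P' * P) = (Q' * Q) * E"
    by (metis 1(1) 2(1) mult.assoc)
  moreover have "P' * P \<noteq> S * E" for S
  proof
    assume "P' * P = S * E"
    then have "X' * S * E = (X' * P') * P" by (simp add: mult.assoc)
    then have "P = (X' * S - S' * Q) * E"
      by (simp add: 2(2) 1(1) algebra_simps)
    then show False using 1(2) by blast
  qed
  ultimately show ?thesis unfolding has_morphism_def by blast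
qed

lemma diffop_order_left_multiple:
  assumes "P = S * E" "P \<noteq> 0"
  shows "diffop_order P = diffop_order S + diffop_order E"
  using assms diffop_order_times[of S E] by fastforce

lemma diffop_equiv_imp_has_morphism:
  assumes "diffop_equiv E F" "diffop_order E > 0"
  shows "has_morphism E F"
proof -
  from assms obtain P X Q S where 1: "F * P = Q * E" "X * P = 1 + S * E"
    by (auto simp: diffop_equiv_def)
  \<comment> \<open>If \<open>P\<close> vanished modulo \<open>E\<close>, so would 1, which is
    impossible in positive order.\<close>
  have "P \<noteq> V * E" for V
  proof
    assume "P = V * E"
    then have "1 = (X * V - S) * E" using 1(2) by (simp add: algebra_simps)
    then show False
      using assms(2) diffop_order_left_multiple[of 1 "X * V - S" E] by simp
  qed
  then show ?thesis using 1(1) unfolding has_morphism_def by blast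
qed

text \<open>The remainder of \<open>P\<close> modulo \<open>E v\<close> induces the same map on
  solutions, and it is nonzero because \<open>P\<close> is not a left multiple of
  \<open>E v\<close>.\<close>

lemma has_morphism_imp_shift_operator:
  assumes "has_morphism (E v) (E (sh v))" "diffop_order (E v) > 0"
  shows "\<exists>P. is_shift_operator E sh v P"
proof -
  from assms(1) obtain P Q where 1: "E (sh v) * P = Q * E v" "\<And>S. P \<noteq> S * E v"
    by (auto simp: has_morphism_def)
  obtain S R where 2: "P = S * E v + R" "diffop_order R < diffop_order (E v)"
    using diffop_right_division[of "E v" P] assms(2)
    by (metis diffop_coeffs_arith(1) diffop_order_def degree_0 less_numeral_extra(3))
  have "E (sh v) * R = (Q - E (sh v) * S) * E v"
    using 1(1) by (simp add: 2(1) algebra_simps)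
  moreover have "R \<noteq> 0" using 1(2)[of S] 2(1) by auto
  ultimately show ?thesis
    using 2(2) unfolding is_shift_operator_def by blast
qed

text \<open>
  A remainder \<open>R\<close> of order below \<open>n\<close> with \<open>R * P = W * E\<close> and \<open>W \<noteq> 0\<close> would exhibit \<open>P\<close> as a
  right factor of \<open>E\<close>, contradicting left invertibility.
\<close>

lemma diffop_equivI:
  assumes intertwine: "F * P = Q * E" and inverse: "X * P = 1 + S * E"
    and P: "diffop_order P = 1" and ord: "diffop_order E = n" "diffop_order F = n" "n > 0"
  shows "diffop_equiv E F"
proof -
  have nz: "P \<noteq> 0" "E \<noteq> 0" "F \<noteq> 0"
    using P ord by (auto simp: diffop_order_def)
  have rem: "R = 0" if R: "R * P = W * E" "diffop_order R < n" for R W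
  proof (rule ccontr)
    assume "R \<noteq> 0"
    then have "W \<noteq> 0" using R(1) nz diffop_times_nonzero by force
    \<comment> \<open>Comparing orders gives ord R + 1 = ord W + n, while ord R < n.\<close>
    then have "diffop_order W = 0"
      using R \<open>R \<noteq> 0\<close> nz diffop_order_times[of R P] diffop_order_times[of W E] P ord by simp
    then obtain w where w: "W = mult_op w" by (rule diffop_order_0E)
    with \<open>W \<noteq> 0\<close> have "w \<noteq> 0" by auto
    then have "mult_op (1 / w) * W = 1"
      by (simp add: w flip: mult_op_mult)
    then have "E = mult_op (1 / w) * R * P"
      using R(1) by (metis mult.assoc mult_1)
    then have one: "(X - S * mult_op (1 / w) * R) * P = 1"
      using inverse by (simp add: algebra_simps)
    then have "X - S * mult_op (1 / w) * R \<noteq> 0" by auto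
    from diffop_order_times[OF this nz(1)] show False
      by (simp add: one P)
  qed
  \<comment> \<open>The missing relations, that modulo \<open>F\<close> the product
    \<open>E * X\<close> is 0 and \<open>P * X\<close> is 1, follow from the one-sided data: each
    remainder modulo \<open>F\<close>, multiplied by \<open>P\<close>, is a left multiple of
    \<open>E\<close>, so \<open>rem\<close> applies.\<close>
  obtain Y R where Y: "E * X = Y * F + R" "diffop_order R < n"
    using diffop_right_division[of F "E * X"] nz ord by metis
  have "R * P = E * (X * P) - Y * (F * P)"
    by (simp add: Y(1) algebra_simps flip: mult.assoc)
  also have "\<dots> = (1 + E * S - Y * Q) * E"
    by (simp add: inverse intertwine algebra_simps)
  finally have "R = 0" using rem Y(2) by blast
  obtain T R' where T: "P * X - 1 = T * F + R'" "diffop_order R' < n"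
    using diffop_right_division[of F "P * X - 1"] nz ord by metis
  have "R' * P = (P * X - 1 - T * F) * P" by (simp add: T(1))
  also have "\<dots> = P * (X * P) - P - T * (F * P)"
    by (simp add: algebra_simps)
  also have "\<dots> = (P * S - T * Q) * E"
    by (simp add: inverse intertwine algebra_simps)
  finally have "R' = 0" using rem T(2) by blast
  have "P * X = 1 + T * F" "E * X = Y * F"
    using T(1) Y(1) \<open>R = 0\<close> \<open>R' = 0\<close> by (simp_all add: algebra_simps)
  then show ?thesis
    using intertwine inverse unfolding diffop_equiv_def by blast
qed

subsection \<open>Polynomials in the Euler operator\<close>

lemma diffop_order_times_ddx_pow:
  "diffop_order A \<le> m \<Longrightarrow> diffop_order (A * ddx ^ k) \<le> m + k"
  by (rule diffop_order_times_le[OF _ diffop_order_ddx_pow])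

lemma coeff_times_ddx:
  "coeff (diffop_coeffs (A * ddx)) n = (case n of 0 \<Rightarrow> 0 | Suc m \<Rightarrow> coeff (diffop_coeffs A) m)"
proof -
  let ?a = "diffop_coeffs A"
  have "(ore_step ^^ i) [:0, 1:] = monom 1 (Suc i)" for i
    using ore_step_pow_1[of "Suc i"] ore_step_pow_1[of 1]
    by (simp add: monom_Suc funpow_swap1 one_pCons monom_0)
  then have "diffop_coeffs (A * ddx) = (\<Sum>i\<le>degree ?a. monom (coeff ?a i) (Suc i))"
    by (simp add: times_diffop.rep_eq ddx_rep ore_mult_def smult_monom)
  then have "coeff (diffop_coeffs (A * ddx)) n = (\<Sum>i\<le>degree ?a. if n = Suc i then coeff ?a i else 0)"
    by (auto simp: coeff_sum intro!: sum.cong)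
  then show ?thesis
    by (cases n) (auto simp: coeff_eq_0 not_le)
qed

section \<open>Constants, and the commutation of \<partial> with \<theta>\<close>

lemma ratfun_const_to_fract: "ratfun_const c = to_fract [:c:]"
  by (simp add: ratfun_const_def to_fract_def)

lemma ratfun_X_to_fract: "ratfun_X = to_fract [:0, 1:]"
  by (simp add: ratfun_X_def to_fract_def)

lemma ratfun_const_simps [simp]:
  "ratfun_const 0 = 0" "ratfun_const 1 = 1"
  "ratfun_const (a + b) = ratfun_const a + ratfun_const b"
  "ratfun_const (a - b) = ratfun_const a - ratfun_const b"
  "ratfun_const (- a) = - ratfun_const a"
  "ratfun_const (a * b) = ratfun_const a * ratfun_const b"
  by (simp_all add: ratfun_const_to_fract flip: to_fract_add to_fract_diff to_fract_uminus to_fract_mult one_pCons)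

lemma ratfun_const_eq_0_iff [simp]: "ratfun_const a = 0 \<longleftrightarrow> a = 0"
  by (simp add: ratfun_const_to_fract)

lemma cst_commute_theta: "theta * cst c = cst c * theta"
proof -
  have "theta * cst c = mult_op ratfun_X * (ddx * cst c)"
    by (simp add: theta_def mult.assoc)
  also have "\<dots> = cst c * theta"
    by (simp add: ddx_mult_op theta_def mult.commute flip: mult.assoc mult_op_mult)
  finally show ?thesis .
qed

lemma ddx_cst: "ddx * cst c = cst c * ddx"
  by (simp add: ddx_mult_op)

lemma ddx_theta: "ddx * theta = (theta + 1) * ddx"
  by (simp add: theta_def ddx_mult_op algebra_simps flip: mult.assoc)

definition theta_poly :: "complex poly \<Rightarrow> diffop" where
  "theta_poly f = fold_coeffs (\<lambda>c A. cst c + theta * A) f 0"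

lemma theta_poly_0 [simp]: "theta_poly 0 = 0"
  by (simp add: theta_poly_def)

lemma theta_poly_pCons: "theta_poly (pCons c f) = cst c + theta * theta_poly f"
  by (cases "c = 0 \<and> f = 0") (auto simp: theta_poly_def)

lemma theta_poly_const [simp]: "theta_poly [:c:] = cst c"
  by (simp add: theta_poly_pCons)

lemma theta_poly_1 [simp]: "theta_poly 1 = 1"
  by (simp add: one_pCons)

lemma theta_poly_add: "theta_poly (f + g) = theta_poly f + theta_poly g"
  by (induction f g rule: poly_induct2)
     (simp_all add: theta_poly_pCons mult_op_add algebra_simps)

lemma theta_poly_smult: "theta_poly (smult c f) = cst c * theta_poly f"
  by (induction f)
     (simp_all add: theta_poly_pCons mult_op_mult distrib_left cst_commute_theta flip: mult.assoc)

lemma theta_poly_mult: "theta_poly (f * g) = theta_poly f * theta_poly g"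
  by (induction f)
     (simp_all add: theta_poly_pCons theta_poly_add theta_poly_smult algebra_simps)

lemma theta_poly_uminus: "theta_poly (- f) = - theta_poly f"
  using theta_poly_add[of f "- f"] by (simp add: eq_neg_iff_add_eq_0 add.commute)

lemma theta_poly_sum: "theta_poly (sum f I) = (\<Sum>i\<in>I. theta_poly (f i))"
  by (induction I rule: infinite_finite_induct) (simp_all add: theta_poly_add)

lemma ddx_theta_poly: "ddx * theta_poly f = theta_poly (f \<circ>\<^sub>p [:1, 1:]) * ddx"
proof (induction f)
  case (pCons c f)
  have "ddx * (theta * theta_poly f) = (theta + 1) * (ddx * theta_poly f)"
    by (simp add: ddx_theta flip: mult.assoc)
  also have "\<dots> = (theta + 1) * theta_poly (f \<circ>\<^sub>p [:1, 1:]) * ddx"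
    by (simp add: pCons.IH mult.assoc)
  finally show ?case
    by (simp add: theta_poly_pCons pcompose_pCons theta_poly_add theta_poly_smult ddx_cst algebra_simps)
qed simp

lemma ddx_pow_theta_poly:
  "ddx ^ k * theta_poly f = theta_poly (f \<circ>\<^sub>p [:of_nat k, 1:]) * ddx ^ k"
proof (induction k)
  case (Suc k)
  have "ddx ^ Suc k * theta_poly f = ddx * theta_poly (f \<circ>\<^sub>p [:of_nat k, 1:]) * ddx ^ k"
    by (simp add: Suc.IH mult.assoc)
  also have "\<dots> = theta_poly (f \<circ>\<^sub>p [:of_nat k, 1:] \<circ>\<^sub>p [:1, 1:]) * ddx ^ Suc k"
    by (simp add: ddx_theta_poly mult.assoc)
  also have "f \<circ>\<^sub>p [:of_nat k, 1:] \<circ>\<^sub>p [:1, 1:] = f \<circ>\<^sub>p [:of_nat (Suc k), 1:]"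
    by (simp add: pcompose_assoc[symmetric] pcompose_pCons add.commute)
  finally show ?case .
qed simp

text \<open>The operators \<open>A * ddx\<close> are those that kill the constant function 1. As
  \<theta> is one of them, the remainder is the value on 1.\<close>

lemma theta_poly_factor_ddx: "\<exists>A. theta_poly f = A * ddx + cst (poly f 0)"
proof (cases f)
  case (pCons c g)
  have "theta * theta_poly g = theta_poly g * theta"
    using theta_poly_mult[of "[:0, 1:]" g] theta_poly_mult[of g "[:0, 1:]"]
    by (simp add: theta_poly_pCons mult.commute)
  then have "theta_poly f = theta_poly g * mult_op ratfun_X * ddx + cst (poly f 0)"
    by (simp add: pCons theta_poly_pCons theta_def mult.assoc)
  then show ?thesis by blast
qed

lemma
  assumes "degree f \<le> n"
  shows diffop_order_theta_poly_le: "diffop_order (theta_poly f) \<le> n"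
    and coeff_theta_poly_top:
      "coeff (diffop_coeffs (theta_poly f)) n = ratfun_const (coeff f n) * ratfun_X ^ n"
proof -
  have "diffop_order (theta_poly f) \<le> n \<and>
    coeff (diffop_coeffs (theta_poly f)) n = ratfun_const (coeff f n) * ratfun_X ^ n"
    using assms
  proof (induction n arbitrary: f)
    case 0
    then obtain c where "f = [:c:]" by (metis degree_0_id le_zero_eq)
    then show ?case by (simp add: mult_op_rep)
  next
    case (Suc n)
    obtain c g where f: "f = pCons c g" by (cases f)
    have g: "degree g \<le> n"
      using Suc.prems by (auto simp: f split: if_splits)
    have th: "diffop_order theta \<le> 1" "coeff (diffop_coeffs theta) 1 = ratfun_X"
      using diffop_order_times_le[of "mult_op ratfun_X" 0 ddx 1]
      by (simp_all add: theta_def coeff_mult_op_times ddx_rep diffop_order_def[of ddx])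
    note IH = Suc.IH[OF g]
    have "diffop_order (theta * theta_poly g) \<le> Suc n"
      using diffop_order_times_le[OF th(1), of "theta_poly g" n] IH by simp
    then show ?case
      using coeff_times_top[OF th(1), of "theta_poly g" n] IH th(2)
      by (simp add: f theta_poly_pCons diffop_order_def mult_op_rep degree_add_le)
  qed
  then show "diffop_order (theta_poly f) \<le> n"
    "coeff (diffop_coeffs (theta_poly f)) n = ratfun_const (coeff f n) * ratfun_X ^ n"
    by simp_all
qed

subsection \<open>Operators assembled from coefficient polynomials\<close>

text \<open>
  For \<open>F = F\<^sub>0 + F\<^sub>1 y + \<dots>\<close> this is
  \<open>\<Sum>\<^sub>k F\<^sub>k(\<theta> + h) (\<theta> + u + k) \<dots> (\<theta> + u + N - 1) \<partial>\<^sup>k\<close>. It is the middle convolution with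
  parameter \<open>u\<close> of the operator of order \<open>max deg F\<^sub>k\<close> with coefficients \<open>F\<^sub>k\<close>; composition
  of such operators reduces to composition before convolution, in which \<open>u\<close> plays no role.
\<close>

definition conv_op :: "nat \<Rightarrow> complex \<Rightarrow> complex \<Rightarrow> complex poly poly \<Rightarrow> diffop" where
  "conv_op N u h F =
     (\<Sum>k\<le>N. theta_poly ((coeff F k \<circ>\<^sub>p [:h, 1:]) * (\<Prod>i=k..<N. [:u + of_nat i, 1:])) * ddx ^ k)"

lemma prod_linear_pcompose_shift:
  "(\<Prod>i=k..<N. [:u + of_nat i, 1:]) \<circ>\<^sub>p [:of_nat m, 1:]
     = (\<Prod>i=k + m..<N + m. [:u + of_nat i, 1:])" for u :: "'a :: comm_ring_1"
  unfolding prod.shift_bounds_nat_ivl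
  by (simp add: pcompose_prod pcompose_pCons algebra_simps)

text \<open>Moving \<open>ddx ^ i\<close> to the right turns the linear factors of the right operand
  into (\<theta> + u + i + j) ... (\<theta> + u + i + M - 1). The factors of the left operand start
  at \<theta> + u + M + i, exactly where these end, because its parameter is u + M; this is why
  composition forces a shift of r. Up to the offset s, the inner sum is the product in the skew ring
  with y w = (w + 1) y.\<close>

lemma conv_op_mult:
  assumes "degree F \<le> N" "degree G \<le> M"
  shows "conv_op N (u + of_nat M) (h + s) F * conv_op M u h G
     = (\<Sum>n\<le>N + M. theta_poly (((\<Sum>i\<le>n. (coeff F i \<circ>\<^sub>p [:s, 1:]) * (coeff G (n - i) \<circ>\<^sub>p [:of_nat i, 1:]))
           \<circ>\<^sub>p [:h, 1:])
         * (\<Prod>i=n..<N + M. [:u + of_nat i, 1:])) * ddx ^ n)"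
    (is "_ = (\<Sum>n\<le>N + M. theta_poly (?c n * ?p n) * _)")
proof -
  define t where "t i j = theta_poly (((coeff F i \<circ>\<^sub>p [:s, 1:]) * (coeff G j \<circ>\<^sub>p [:of_nat i, 1:]))
      \<circ>\<^sub>p [:h, 1:] * ?p (i + j)) * ddx ^ (i + j)" for i j
  have t: "theta_poly ((coeff F i \<circ>\<^sub>p [:h + s, 1:]) * (\<Prod>k=i..<N. [:u + of_nat M + of_nat k, 1:])) * ddx ^ i
      * (theta_poly ((coeff G j \<circ>\<^sub>p [:h, 1:]) * (\<Prod>k=j..<M. [:u + of_nat k, 1:])) * ddx ^ j) = t i j"
    if "i \<le> N" "j \<le> M" for i j
  proof -
    have 1: "(\<Prod>k=i..<N. [:u + of_nat M + of_nat k, 1:]) = (\<Prod>k=i + M..<N + M. [:u + of_nat k, 1:])"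
      unfolding prod.shift_bounds_nat_ivl by (simp add: algebra_simps)
    have 2: "(\<Prod>k=i + j..<i + M. [:u + of_nat k, 1:]) * (\<Prod>k=i + M..<N + M. [:u + of_nat k, 1:]) = ?p (i + j)"
      using that by (intro prod.atLeastLessThan_concat) auto
    have 3: "coeff F i \<circ>\<^sub>p [:s, 1:] \<circ>\<^sub>p [:h, 1:] = coeff F i \<circ>\<^sub>p [:h + s, 1:]"
      by (simp add: pcompose_assoc[symmetric] pcompose_pCons add.commute)
    have 4: "coeff G j \<circ>\<^sub>p [:h, 1:] \<circ>\<^sub>p [:of_nat i, 1:] = coeff G j \<circ>\<^sub>p [:of_nat i, 1:] \<circ>\<^sub>p [:h, 1:]"
      by (simp add: pcompose_assoc[symmetric] pcompose_pCons add.commute)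
    have "theta_poly ((coeff F i \<circ>\<^sub>p [:h + s, 1:]) * (\<Prod>k=i..<N. [:u + of_nat M + of_nat k, 1:])) * ddx ^ i
      * (theta_poly ((coeff G j \<circ>\<^sub>p [:h, 1:]) * (\<Prod>k=j..<M. [:u + of_nat k, 1:])) * ddx ^ j)
      = theta_poly ((coeff F i \<circ>\<^sub>p [:h + s, 1:]) * (\<Prod>k=i..<N. [:u + of_nat M + of_nat k, 1:]))
        * (ddx ^ i * theta_poly ((coeff G j \<circ>\<^sub>p [:h, 1:]) * (\<Prod>k=j..<M. [:u + of_nat k, 1:]))) * ddx ^ j"
      by (simp add: mult.assoc)
    also have "\<dots> = theta_poly ((coeff F i \<circ>\<^sub>p [:h + s, 1:]) * (\<Prod>k=i + M..<N + M. [:u + of_nat k, 1:])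
        * ((coeff G j \<circ>\<^sub>p [:of_nat i, 1:] \<circ>\<^sub>p [:h, 1:]) * (\<Prod>k=j + i..<M + i. [:u + of_nat k, 1:]))) * ddx ^ (i + j)"
      unfolding ddx_pow_theta_poly pcompose_mult prod_linear_pcompose_shift 1 4
      by (simp add: theta_poly_mult power_add mult.assoc)
    also have "\<dots> = t i j"
      unfolding t_def pcompose_mult 3 2[symmetric] by (simp add: algebra_simps)
    finally show ?thesis .
  qed
  have "conv_op N (u + of_nat M) (h + s) F * conv_op M u h G = (\<Sum>i\<le>N. \<Sum>j\<le>M. t i j)"
    unfolding conv_op_def sum_product by (intro sum.cong refl t) auto
  also have "\<dots> = (\<Sum>(i, j)\<in>{..N} \<times> {..M}. t i j)"
    by (simp add: sum.cartesian_product)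
  \<comment> \<open>By the degree bounds all terms outside the rectangle vanish, so it may be
    enlarged to a triangle, which is then summed along the diagonals i + j = n.\<close>
  also have "\<dots> = (\<Sum>(i, j)\<in>{(i, j). i + j \<le> N + M}. t i j)"
  proof (rule sum.mono_neutral_left)
    have "{(i, j). i + j \<le> N + M} \<subseteq> {..N + M} \<times> {..N + M}" by auto
    then show "finite {(i, j). i + j \<le> N + M}"
      by (rule finite_subset) simp
    have "t i j = 0" if "i > N \<or> j > M" for i j
    proof -
      have "coeff F i = 0 \<or> coeff G j = 0"
        using that assms by (auto intro: coeff_eq_0)
      then show ?thesis by (auto simp: t_def)
    qed
    then show "\<forall>x\<in>{(i, j). i + j \<le> N + M} - {..N} \<times> {..M}. (case x of (i, j) \<Rightarrow> t i j) = 0"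
      by (auto simp: not_le[symmetric])
  qed auto
  also have "\<dots> = (\<Sum>n\<le>N + M. \<Sum>i\<le>n. t i (n - i))"
    by (rule sum.triangle_reindex_eq)
  also have "\<dots> = (\<Sum>n\<le>N + M. theta_poly (?c n * ?p n) * ddx ^ n)"
    by (simp add: t_def theta_poly_sum pcompose_sum sum_distrib_right)
  finally show ?thesis .
qed

lemma conv_op_multI:
  assumes "degree F \<le> N" "degree G \<le> M"
    and "\<And>n w. n \<le> N + M \<Longrightarrow> (\<Sum>i\<le>n. poly (coeff F i) (w + s) * poly (coeff G (n - i)) (w + of_nat i))
      = poly (coeff H n) w"
  shows "conv_op N (u + of_nat M) (h + s) F * conv_op M u h G = conv_op (N + M) u h H"
proof -
  have "(\<Sum>i\<le>n. (coeff F i \<circ>\<^sub>p [:s, 1:]) * (coeff G (n - i) \<circ>\<^sub>p [:of_nat i, 1:])) = coeff H n"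
    if "n \<le> N + M" for n
    using assms(3)[OF that]
    by (intro poly_eq_poly_eq_iff[THEN iffD1] ext) (simp add: poly_sum poly_pcompose add.commute)
  then show ?thesis
    unfolding conv_op_mult[OF assms(1,2)] by (simp add: conv_op_def)
qed

text \<open>Since N + M = M + N, both composites carry the same linear factors; it suffices to match
  the coefficients in front of them, and u drops out.\<close>

lemma conv_op_intertwine:
  assumes "degree A \<le> N" "degree A' \<le> N" "degree P \<le> M" "degree Q \<le> M"
    and "\<And>n w. n \<le> N + M \<Longrightarrow> (\<Sum>i\<le>n. poly (coeff A' i) (w + s) * poly (coeff P (n - i)) (w + of_nat i))
      = (\<Sum>i\<le>n. poly (coeff Q i) w * poly (coeff A (n - i)) (w + of_nat i))"
  shows "conv_op N (u + of_nat M) (h + s) A' * conv_op M u h P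
    = conv_op M (u + of_nat N) h Q * conv_op N u h A"
proof -
  have eq: "(\<Sum>i\<le>n. (coeff A' i \<circ>\<^sub>p [:s, 1:]) * (coeff P (n - i) \<circ>\<^sub>p [:of_nat i, 1:]))
      = (\<Sum>i\<le>n. (coeff Q i \<circ>\<^sub>p [:0, 1:]) * (coeff A (n - i) \<circ>\<^sub>p [:of_nat i, 1:]))" if "n \<le> N + M" for n
    using assms(5)[OF that]
    by (intro poly_eq_poly_eq_iff[THEN iffD1] ext)
       (simp add: poly_sum poly_pcompose add.commute)
  show ?thesis
    using conv_op_mult[OF assms(4,1), of u h 0]
    by (simp add: conv_op_mult[OF assms(2,3)] eq add.commute)
qed

text \<open>The k-th summand is a polynomial in \<theta> of degree at most D + N - k, followed by
  \<open>ddx ^ k\<close>. As \<theta>^m has leading term x^m \<partial>^m, all summands can reach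
  the same order N + D, and the powers of x keep their contributions apart.\<close>

lemma
  assumes "\<And>k. degree (coeff F k) \<le> D"
  shows diffop_order_conv_op_le: "diffop_order (conv_op N u h F) \<le> N + D"
    and coeff_conv_op_top: "coeff (diffop_coeffs (conv_op N u h F)) (N + D)
      = (\<Sum>k\<le>N. ratfun_const (coeff (coeff F k) D) * ratfun_X ^ (N + D - k))"
proof -
  have prod: "degree (\<Prod>i=k..<N. [:u + of_nat i, 1:]) = N - k"
    "coeff (\<Prod>i=k..<N. [:u + of_nat i, 1:]) (N - k) = 1" for k
    using lead_coeff_prod[of "\<lambda>i. [:u + of_nat i, 1:]" "{k..<N}"]
    by (simp_all add: degree_prod_eq_sum_degree)
  have comp: "degree (coeff F k \<circ>\<^sub>p [:h, 1:]) \<le> D"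
    "coeff (coeff F k \<circ>\<^sub>p [:h, 1:]) D = coeff (coeff F k) D" for k
    using assms[of k] lead_coeff_comp[of "[:h, 1:]" "coeff F k"]
    by (auto simp: degree_pcompose coeff_eq_0 le_less)
  let ?t = "\<lambda>k. theta_poly ((coeff F k \<circ>\<^sub>p [:h, 1:]) * (\<Prod>i=k..<N. [:u + of_nat i, 1:]))"
  have deg: "degree ((coeff F k \<circ>\<^sub>p [:h, 1:]) * (\<Prod>i=k..<N. [:u + of_nat i, 1:])) \<le> D + (N - k)" for k
    using degree_mult_le[of "coeff F k \<circ>\<^sub>p [:h, 1:]" "\<Prod>i=k..<N. [:u + of_nat i, 1:]"] comp(1)[of k] prod(1)[of k]
    by linarith
  have top: "coeff ((coeff F k \<circ>\<^sub>p [:h, 1:]) * (\<Prod>i=k..<N. [:u + of_nat i, 1:])) (D + (N - k)) = coeff (coeff F k) D" for k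
  proof (cases "degree (coeff F k \<circ>\<^sub>p [:h, 1:]) = D")
    case True
    then show ?thesis
      using coeff_mult_degree_sum[of "coeff F k \<circ>\<^sub>p [:h, 1:]" "\<Prod>i=k..<N. [:u + of_nat i, 1:]"] comp(2)[of k] prod[of k]
      by simp
  next
    case False
    then have "degree (coeff F k \<circ>\<^sub>p [:h, 1:]) < D" using comp(1)[of k] by simp
    moreover from this have "degree ((coeff F k \<circ>\<^sub>p [:h, 1:]) * (\<Prod>i=k..<N. [:u + of_nat i, 1:])) < D + (N - k)"
      using degree_mult_le[of "coeff F k \<circ>\<^sub>p [:h, 1:]" "\<Prod>i=k..<N. [:u + of_nat i, 1:]"] prod(1)[of k]
      by linarith
    ultimately show ?thesis using comp(2)[of k] by (simp add: coeff_eq_0)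
  qed
  have "diffop_order (?t k * ddx ^ k) \<le> N + D" if "k \<le> N" for k
    using diffop_order_times_ddx_pow[OF diffop_order_theta_poly_le[OF deg], of k k] that by simp
  then show "diffop_order (conv_op N u h F) \<le> N + D"
    unfolding conv_op_def diffop_order_def diffop_coeffs_sum by (intro degree_sum_le) auto
  have "coeff (diffop_coeffs (?t k * ddx ^ k)) (N + D) = ratfun_const (coeff (coeff F k) D) * ratfun_X ^ (N + D - k)"
    if "k \<le> N" for k
    using coeff_times_top[OF diffop_order_theta_poly_le[OF deg] diffop_order_ddx_pow, of k k]
      coeff_theta_poly_top[OF deg, of k] top[of k] that
    by (simp add: coeff_ddx_pow top add.commute)
  then show "coeff (diffop_coeffs (conv_op N u h F)) (N + D)
      = (\<Sum>k\<le>N. ratfun_const (coeff (coeff F k) D) * ratfun_X ^ (N + D - k))"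
    by (simp add: conv_op_def diffop_coeffs_sum coeff_sum)
qed

text \<open>On the constant function 1 the summands with k > 0 vanish, and in the remaining one
  \<theta> acts as 0.\<close>

lemma conv_op_factor_ddx:
  "\<exists>A. conv_op N u h F = A * ddx + cst (poly (coeff F 0) h * (\<Prod>i<N. u + of_nat i))"
proof -
  obtain A where A: "theta_poly ((coeff F 0 \<circ>\<^sub>p [:h, 1:]) * (\<Prod>i=0..<N. [:u + of_nat i, 1:]))
      = A * ddx + cst (poly (coeff F 0) h * (\<Prod>i<N. u + of_nat i))"
    using theta_poly_factor_ddx[of "(coeff F 0 \<circ>\<^sub>p [:h, 1:]) * (\<Prod>i=0..<N. [:u + of_nat i, 1:])"]
    by (auto simp: poly_pcompose poly_prod lessThan_atLeast0)
  have "conv_op N u h F = (A + (\<Sum>k=1..N. theta_poly ((coeff F k \<circ>\<^sub>p [:h, 1:]) * (\<Prod>i=k..<N. [:u + of_nat i, 1:])) * ddx ^ (k - 1))) * ddx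
      + cst (poly (coeff F 0) h * (\<Prod>i<N. u + of_nat i))"
    unfolding conv_op_def atMost_atLeast0
    by (subst sum.atLeast_Suc_atMost)
       (auto simp: A algebra_simps sum_distrib_right mult.assoc power_Suc2[symmetric] simp del: power_Suc intro!: sum.cong)
  then show ?thesis by blast
qed

lemma coeff_0_conv_op:
  "coeff (diffop_coeffs (conv_op N u h F)) 0 = ratfun_const (poly (coeff F 0) h * (\<Prod>i<N. u + of_nat i))"
proof -
  obtain A where "conv_op N u h F = A * ddx + cst (poly (coeff F 0) h * (\<Prod>i<N. u + of_nat i))"
    using conv_op_factor_ddx by blast
  then show ?thesis by (simp add: coeff_times_ddx mult_op_rep)
qed

subsection \<open>The operator SE6 as a convolution\<close>

text \<open>The coefficients \<open>F\<^sub>k\<close> of \<open>SE6\<close> as polynomials in \<open>w = \<theta> - p - r\<close>.\<close>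

definition SE6_coeff0 :: "complex \<Rightarrow> complex \<Rightarrow> complex \<Rightarrow> complex \<Rightarrow> complex \<Rightarrow> complex poly" where
  "SE6_coeff0 a b c g q = [:- (2 * c + q + 1), 1:] * [:- (a + b + 2 * c + g + q + 2), 1:]
     * [:- (2 * a + 2 * b + 2 * c + g + q + 3), 1:]"

text \<open>This is \<open>B1\<close> of \<open>E6\<close> at the exponents of \<open>SE6\<close>,
  expanded in powers of w instead of \<theta>; p and r cancel.\<close>

definition SE6_coeff1 :: "complex \<Rightarrow> complex \<Rightarrow> complex \<Rightarrow> complex \<Rightarrow> complex \<Rightarrow> complex poly" where
  "SE6_coeff1 a b c g q =
    [:8 * a^2 * c + 4 * a^2 * q + 12 * a * b * c + 4 * a * b * q + 20 * a * c^2 + 10 * a * c * g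
      + 16 * a * c * q + 4 * a * g * q + 3 * a * q^2 + 4 * b^2 * c + 16 * b * c^2
      + 8 * b * c * g + 8 * b * c * q + 2 * b * g * q + 12 * c^3 + 12 * c^2 * g + 12 * c^2 * q
      + 3 * c * g^2 + 8 * c * g * q + 3 * c * q^2 + g^2 * q + g * q^2 + 14 * a * c + 5 * a * q
      + 10 * b * c + 18 * c^2 + 9 * c * g + 9 * c * q + 2 * g * q + 6 * c,
      - 6 * a^2 - 8 * a * b - 28 * a * c - 7 * a * g - 12 * a * q - 2 * b^2 - 20 * b * c
      - 5 * b * g - 6 * b * q - 24 * c^2 - 16 * c * g - 18 * c * q - 2 * g^2 - 6 * g * q
      - 3 * q^2 - 12 * a - 7 * b - 27 * c - 7 * g - 9 * q - 6,
      9 * a + 6 * b + 15 * c + 5 * g + 6 * q + 9,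
      - 3:]"

definition SE6_coeff2 :: "complex \<Rightarrow> complex \<Rightarrow> complex \<Rightarrow> complex \<Rightarrow> complex \<Rightarrow> complex poly" where
  "SE6_coeff2 a b c g q =
    [:- 4 * a^2 * c - 2 * a^2 * q - 4 * a * b * c - 8 * a * c^2 - 4 * a * c * g - 4 * a * c * q
      - a * g * q - 4 * b * c^2 - 2 * b * c * g - 4 * c^3 - 4 * c^2 * g - 2 * c^2 * q - c * g^2
      - c * g * q + 6 * a^2 + 4 * a * b + 14 * a * c + 5 * a * g + 5 * a * q + 6 * b * c
      + 2 * b * g + 8 * c^2 + 6 * c * g + 5 * c * q + g^2 + 2 * g * q + 3 * a + 5 * c + g,
      6 * a^2 + 4 * a * b + 20 * a * c + 5 * a * g + 6 * a * q + 8 * b * c + 2 * b * g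
      + 14 * c^2 + 9 * c * g + 6 * c * q + g^2 + 2 * g * q - 6 * a - 3 * b - 5 * c - 3 * g
      - 3 * q - 3,
      - 9 * a - 3 * b - 12 * c - 4 * g - 3 * q,
      3:]"

definition SE6_coeff3 :: "complex \<Rightarrow> complex \<Rightarrow> complex \<Rightarrow> complex \<Rightarrow> complex \<Rightarrow> complex poly" where
  "SE6_coeff3 a b c g q = - ([:2, 1:] * [:1 - a - c, 1:] * [:- (2 * a + 2 * c + g), 1:])"

definition SE6_coeffs :: "(param \<Rightarrow> complex) \<Rightarrow> complex poly poly" where
  "SE6_coeffs v = (let a = v par_a; b = v par_b; c = v par_c; g = v par_g; q = v par_q
     in [:SE6_coeff0 a b c g q, SE6_coeff1 a b c g q, SE6_coeff2 a b c g q, SE6_coeff3 a b c g q:])"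

lemma theta_plus_cst: "theta + cst c = theta_poly [:c, 1:]"
  by (simp add: theta_poly_pCons add.commute)

lemma theta_poly_cubic:
  "cst t3 * theta ^ 3 + cst t2 * theta ^ 2 + cst t1 * theta + cst t0 = theta_poly [:t0, t1, t2, t3:]"
  by (simp add: theta_poly_pCons algebra_simps power2_eq_square power3_eq_cube cst_commute_theta)
     (simp add: cst_commute_theta flip: mult.assoc)

lemma conv_op_3:
  "conv_op 3 u h [:f0, f1, f2, f3:] =
     theta_poly ((f0 \<circ>\<^sub>p [:h, 1:]) * ([:u, 1:] * [:u + 1, 1:] * [:u + 2, 1:]))
     + theta_poly ((f1 \<circ>\<^sub>p [:h, 1:]) * ([:u + 1, 1:] * [:u + 2, 1:])) * ddx
     + theta_poly ((f2 \<circ>\<^sub>p [:h, 1:]) * [:u + 2, 1:]) * ddx ^ 2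
     + theta_poly (f3 \<circ>\<^sub>p [:h, 1:]) * ddx ^ 3"
  by (simp add: conv_op_def numeral_3_eq_3 numeral_2_eq_2 prod.atLeast_Suc_lessThan add.assoc del: mult_pCons_left mult_pCons_right)

text \<open>The hypotheses \<open>t12\<close> to \<open>t20\<close> compare \<open>B1\<close> and
  \<open>B2\<close>, given in powers of \<theta>, with polynomials in w = \<theta> + h by Taylor
  expansion. Denominators are cleared, so that for \<open>SE6\<close> they become polynomial
  identities in the parameters.\<close>

lemma E6_eq_conv_op:
  fixes e1 e2 e3 e4 e5 e6 e7 e8 e9 :: complex
  defines "s11 \<equiv> e1 + e2 + e3" and "s12 \<equiv> e4 + e5 + e6" and "s13 \<equiv> e7 + e8 + e9"
    and "s21 \<equiv> e1 * e2 + e1 * e3 + e2 * e3" and "s22 \<equiv> e4 * e5 + e4 * e6 + e5 * e6"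
    and "s23 \<equiv> e7 * e8 + e7 * e9 + e8 * e9"
    and "s31 \<equiv> e1 * e2 * e3" and "s32 \<equiv> e4 * e5 * e6" and "s33 \<equiv> e7 * e8 * e9"
  assumes s: "e1 + e2 + e3 + e4 + e5 + e6 + e7 + e8 + e9 = 6 - 3 * s"
    and f0: "\<And>x. poly f0 (x + h) = (x + e7) * (x + e8) * (x + e9)"
    and f3: "\<And>x. poly f3 (x + h) = - ((x + (3 - e1)) * (x + (3 - e2)) * (x + (3 - e3)))"
    and t12: "c2 - 9 * h = - 9 + s11 - 2 * s13"
    and t11: "3 * (c1 + 2 * c2 * h - 9 * h^2 + 8) = s11^2 + 2 * s11 * s13 - s12^2 + s13^2
      + 3 * (s11 - 5 * s13 - s21 + s22 - 2 * s23)"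
    and t10: "27 * (2 * (c0 + c1 * h + c2 * h^2 - 3 * h^3) + 5 + s21 - s31 - s22 + s32 + 5 * s23 + 3 * s33)
      = 9 * (2 * s11 + s11^2 + 2 * s11 * s13 - s12^2 + s13^2 - s11 * s21 + 2 * s11 * s23
          + s12 * s22 - 2 * s13 * s21 + 2 * s13 * s22 + s13 * s23 - 14 * s13)
        + 6 * (s11^2 * s13 - s12^2 * s13) + 2 * (s11^3 - s12^3)"
    and t22: "d2 + 9 * h = 18 + s13 - 2 * s11"
    and t21: "3 * (d1 + 2 * d2 * h + 9 * h^2 - 35) = - (s11^2) - 2 * s11 * s13 + s12^2 - s13^2
      + 3 * (- 7 * s11 + 5 * s13 + 2 * s21 - s22 + s23)"
    and t20: "27 * (d0 + d1 * h + d2 * h^2 + 3 * h^3 + (c0 + c1 * h + c2 * h^2 - 3 * h^3) - 19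
        + 5 * s11 - 4 * s13 - 3 * s21 + 2 * s22 + s31 + s32 + s33)
      = 3 * (s11^2 * s13 - s11 * s12^2 + s11 * s13^2 - s12^2 * s13) + (s13^3 + s11^3 - 2 * s12^3)
        + 9 * (- 2 * s11^2 - 4 * s11 * s13 + s11 * s22 + 2 * s12^2 + s22 * s12 - 2 * s13^2 + s22 * s13)"
  shows "E6 e1 e2 e3 e4 e5 e6 e7 e8 e9 = conv_op 3 s h [:f0, [:c0, c1, c2, - 3:], [:d0, d1, d2, 3:], f3:]"
proof -
  have s': "(6 - (e1 + e2 + e3 + e4 + e5 + e6 + e7 + e8 + e9)) / 3 = s"
    by (simp add: s)
  have T11: "- 8 + (s11^2 + 2 * s11 * s13 - s12^2 + s13^2) / 3 + s11 - 5 * s13 - s21 + s22 - 2 * s23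
      = c1 + 2 * c2 * h - 9 * h^2"
  proof -
    \<comment> \<open>Abstracting the quadratic part to \<open>A\<close> leaves a linear
      equation.\<close>
    have "- 8 + A / 3 + s11 - 5 * s13 - s21 + s22 - 2 * s23 = t"
      if "3 * (t + 8) = A + 3 * (s11 - 5 * s13 - s21 + s22 - 2 * s23)" for A t
      using that by (simp add: field_simps)
    from this[OF t11] show ?thesis .
  qed
  have T21: "35 + (- (s11^2) - 2 * s11 * s13 + s12^2 - s13^2) / 3 - 7 * s11 + 5 * s13 + 2 * s21 - s22 + s23
      = d1 + 2 * d2 * h + 9 * h^2"
  proof -
    have "35 + A / 3 - 7 * s11 + 5 * s13 + 2 * s21 - s22 + s23 = t"
      if "3 * (t - 35) = A + 3 * (- 7 * s11 + 5 * s13 + 2 * s21 - s22 + s23)" for A t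
      using that by (simp add: field_simps)
    from this[OF t21] show ?thesis .
  qed
  have T10: "((2 * s11 + s11^2 + 2 * s11 * s13 - s12^2 + s13^2 - s11 * s21 + 2 * s11 * s23
          + s12 * s22 - 2 * s13 * s21 + 2 * s13 * s22 + s13 * s23 - 14 * s13) / 3
        + 2 * (s11^2 * s13 - s12^2 * s13) / 9 + 2 * (s11^3 - s12^3) / 27
        - 5 - s21 + s31 + s22 - s32 - 5 * s23 - 3 * s33) / 2
      = c0 + c1 * h + c2 * h^2 - 3 * h^3"
  proof -
    have "(A / 3 + 2 * B / 9 + 2 * C / 27 - 5 - s21 + s31 + s22 - s32 - 5 * s23 - 3 * s33) / 2 = t"
      if "27 * (2 * t + 5 + s21 - s31 - s22 + s32 + 5 * s23 + 3 * s33) = 9 * A + 6 * B + 2 * C" for A B C t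
      using that by (simp add: field_simps)
    from this[OF t10] show ?thesis .
  qed
  have T20: "- (c0 + c1 * h + c2 * h^2 - 3 * h^3) + 19
        + (s11^2 * s13 - s11 * s12^2 + s11 * s13^2 - s12^2 * s13) / 9 + (s13^3 + s11^3 - 2 * s12^3) / 27
        + (- 2 * s11^2 - 4 * s11 * s13 + s11 * s22 + 2 * s12^2 + s22 * s12 - 2 * s13^2 + s22 * s13) / 3
        - 5 * s11 + 4 * s13 + 3 * s21 - 2 * s22 - s31 - s32 - s33
      = d0 + d1 * h + d2 * h^2 + 3 * h^3"
  proof -
    have "- u + 19 + A / 9 + B / 27 + C / 3 - 5 * s11 + 4 * s13 + 3 * s21 - 2 * s22 - s31 - s32 - s33 = t"
      if "27 * (t + u - 19 + 5 * s11 - 4 * s13 - 3 * s21 + 2 * s22 + s31 + s32 + s33) = 3 * A + B + 9 * C"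
      for A B C t u
      using that by (simp add: field_simps)
    from this[OF t20] show ?thesis .
  qed
  have cong: "p7 * p8 * p9 = g0 \<Longrightarrow> b1 = g1 \<Longrightarrow> b2 = g2 \<Longrightarrow> b3 = g3 \<Longrightarrow>
      theta_poly (u2 * u1 * u0 * p7 * p8 * p9) + theta_poly (u2 * u1 * b1) * ddx
        + theta_poly (u2 * b2) * ddx ^ 2 + theta_poly b3 * ddx ^ 3
      = theta_poly (g0 * (u0 * u1 * u2)) + theta_poly (g1 * (u1 * u2)) * ddx
        + theta_poly (g2 * u2) * ddx ^ 2 + theta_poly g3 * ddx ^ 3"
    for p7 p8 p9 u0 u1 u2 b1 b2 b3 g0 g1 g2 g3 by (auto simp: mult_ac)
  show ?thesis
    unfolding conv_op_3 E6_def Let_def s'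
    unfolding s11_def[symmetric] s12_def[symmetric] s13_def[symmetric]
      s21_def[symmetric] s22_def[symmetric] s23_def[symmetric]
      s31_def[symmetric] s32_def[symmetric] s33_def[symmetric]
      T10 T11 T20 T21 t12[symmetric] t22[symmetric] theta_plus_cst theta_poly_cubic
    unfolding theta_poly_mult[symmetric] theta_poly_uminus[symmetric]
  proof (rule cong; rule poly_eq_poly_eq_iff[THEN iffD1]; rule ext)
    fix x
    show "poly ([:e7, 1:] * [:e8, 1:] * [:e9, 1:]) x = poly (f0 \<circ>\<^sub>p [:h, 1:]) x"
      using f0[of x] by (simp add: poly_pcompose algebra_simps)
    show "poly (- ([:3 - e1, 1:] * [:3 - e2, 1:] * [:3 - e3, 1:])) x = poly (f3 \<circ>\<^sub>p [:h, 1:]) x"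
      using f3[of x] by (simp add: poly_pcompose add.commute del: mult_pCons_left mult_pCons_right)
    show "poly [:c0 + c1 * h + c2 * h^2 - 3 * h^3, c1 + 2 * c2 * h - 9 * h^2, c2 - 9 * h, - 3:] x
      = poly ([:c0, c1, c2, - 3:] \<circ>\<^sub>p [:h, 1:]) x"
      unfolding poly_pcompose poly_pCons poly_0 by algebra
    show "poly [:d0 + d1 * h + d2 * h^2 + 3 * h^3, d1 + 2 * d2 * h + 9 * h^2, d2 + 9 * h, 3:] x
      = poly ([:d0, d1, d2, 3:] \<circ>\<^sub>p [:h, 1:]) x"
      unfolding poly_pcompose poly_pCons poly_0 by algebra
  qed
qed

lemma SE6_eq_conv_op:
  "SE6 v = conv_op 3 (- v par_r) (- (v par_p + v par_r)) (SE6_coeffs v)"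
proof -
  define a b c g p q r where abc: "a = v par_a" "b = v par_b" "c = v par_c" "g = v par_g"
    "p = v par_p" "q = v par_q" "r = v par_r"
  show ?thesis
    unfolding SE6_def SE6_coeffs_def Let_def SE6_coeff1_def SE6_coeff2_def abc[symmetric]
  proof (rule E6_eq_conv_op, goal_cases)
    case (2 x)
    show ?case
      unfolding SE6_coeff0_def poly_mult poly_minus poly_pCons poly_0
      by (simp add: algebra_simps)
  next
    case (3 x)
    show ?case
      unfolding SE6_coeff3_def poly_mult poly_minus poly_pCons poly_0 by algebra
  qed algebra+
qed

subsection \<open>Genericity\<close>

definition monom_eval :: "('i \<Rightarrow>\<^sub>0 nat) \<Rightarrow> ('i \<Rightarrow> complex) \<Rightarrow> complex" where
  "monom_eval m v = (\<Prod>i\<in>Poly_Mapping.keys m. v i ^ Poly_Mapping.lookup m i)"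

lemma monom_eval_superset:
  "finite S \<Longrightarrow> Poly_Mapping.keys m \<subseteq> S \<Longrightarrow> monom_eval m v = (\<Prod>i\<in>S. v i ^ Poly_Mapping.lookup m i)"
  unfolding monom_eval_def by (rule prod.mono_neutral_left) (auto simp: in_keys_iff)

lemma monom_eval_0 [simp]: "monom_eval 0 v = 1"
  by (simp add: monom_eval_def)

lemma monom_eval_add: "monom_eval (m + n) v = monom_eval m v * monom_eval n v"
proof -
  let ?S = "Poly_Mapping.keys m \<union> Poly_Mapping.keys n"
  have "Poly_Mapping.keys (m + n) \<subseteq> ?S" by (rule keys_add)
  then show ?thesis
    using monom_eval_superset[of ?S m v] monom_eval_superset[of ?S n v] monom_eval_superset[of ?S "m + n" v]
    by (simp add: lookup_add power_add prod.distrib)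
qed

lemma mpoly_eval_superset:
  "finite S \<Longrightarrow> Poly_Mapping.keys F \<subseteq> S \<Longrightarrow>
     mpoly_eval F v = (\<Sum>m\<in>S. Poly_Mapping.lookup F m * monom_eval m v)"
  unfolding mpoly_eval_def monom_eval_def[symmetric]
  by (rule sum.mono_neutral_left) (auto simp: in_keys_iff)

lemma mpoly_eval_0 [simp]: "mpoly_eval 0 v = 0"
  by (simp add: mpoly_eval_def)

lemma mpoly_eval_single: "mpoly_eval (Poly_Mapping.single m c) v = c * monom_eval m v"
  by (subst mpoly_eval_superset[of "{m}"]) auto

lemma mpoly_eval_add: "mpoly_eval (F + G) v = mpoly_eval F v + mpoly_eval G v"
proof -
  let ?S = "Poly_Mapping.keys F \<union> Poly_Mapping.keys G"
  have "Poly_Mapping.keys (F + G) \<subseteq> ?S" by (rule keys_add)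
  then show ?thesis
    by (simp add: mpoly_eval_superset[of ?S] lookup_add distrib_right sum.distrib)
qed

lemma mpoly_eval_mult: "mpoly_eval (F * G) v = mpoly_eval F v * mpoly_eval G v"
proof -
  have single: "mpoly_eval (Poly_Mapping.single m c * G) v = mpoly_eval (Poly_Mapping.single m c) v * mpoly_eval G v"
    for m c and G :: "('a \<Rightarrow>\<^sub>0 nat) \<Rightarrow>\<^sub>0 complex"
  proof (induction G rule: update_induct)
    case const
    then show ?case by simp
  next
    case (update f n d)
    have "Poly_Mapping.update n d f = f + Poly_Mapping.single n d"
      using update(1) by (intro poly_mapping_eqI)
        (auto simp: lookup_update lookup_add lookup_single in_keys_iff when_def)
    then show ?case
      using update.IH by (simp add: distrib_left mpoly_eval_add mult_single mpoly_eval_single monom_eval_add)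
  qed
  show ?thesis
  proof (induction F rule: update_induct)
    case const
    then show ?case by simp
  next
    case (update f n d)
    have "Poly_Mapping.update n d f = f + Poly_Mapping.single n d"
      using update(1) by (intro poly_mapping_eqI)
        (auto simp: lookup_update lookup_add lookup_single in_keys_iff when_def)
    then show ?case
      using update.IH by (simp add: distrib_right mpoly_eval_add single)
  qed
qed

definition polynomial_map :: "(('i \<Rightarrow> complex) \<Rightarrow> complex) \<Rightarrow> bool" where
  "polynomial_map f \<longleftrightarrow> (\<exists>F. \<forall>v. f v = mpoly_eval F v)"

lemma polynomial_map_const: "polynomial_map (\<lambda>v. c)"
  unfolding polynomial_map_def
  by (rule exI[of _ "Poly_Mapping.single 0 c"]) (simp add: mpoly_eval_single)

lemma polynomial_map_var: "polynomial_map (\<lambda>v. v i)"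
  unfolding polynomial_map_def
  by (rule exI[of _ "Poly_Mapping.single (Poly_Mapping.single i 1) 1"])
     (simp add: mpoly_eval_single monom_eval_def)

lemma polynomial_map_add:
  "polynomial_map f \<Longrightarrow> polynomial_map g \<Longrightarrow> polynomial_map (\<lambda>v. f v + g v)"
  unfolding polynomial_map_def by (metis mpoly_eval_add)

lemma polynomial_map_mult:
  "polynomial_map f \<Longrightarrow> polynomial_map g \<Longrightarrow> polynomial_map (\<lambda>v. f v * g v)"
  unfolding polynomial_map_def by (metis mpoly_eval_mult)

lemma polynomial_map_diff:
  "polynomial_map f \<Longrightarrow> polynomial_map g \<Longrightarrow> polynomial_map (\<lambda>v. f v - g v)"
  using polynomial_map_add[OF _ polynomial_map_mult[OF polynomial_map_const[of "- 1"]], of f g] by simp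

lemma polynomial_map_prod:
  "(\<And>k. k \<in> K \<Longrightarrow> polynomial_map (f k)) \<Longrightarrow> polynomial_map (\<lambda>v. \<Prod>k\<in>K. f k v)"
  by (induction K rule: infinite_finite_induct)
     (auto intro: polynomial_map_const polynomial_map_mult)

lemmas polynomial_map_intros =
  polynomial_map_const polynomial_map_var polynomial_map_add polynomial_map_diff polynomial_map_mult

text \<open>A nonzero value at a single point shows that the representing polynomial is
  nonzero.\<close>

lemma genericallyI:
  assumes "polynomial_map f" "f v \<noteq> 0" "\<And>v. f v \<noteq> 0 \<Longrightarrow> \<Phi> v"
  shows "generically \<Phi>"
proof -
  obtain F where F: "\<And>v. f v = mpoly_eval F v"
    using assms(1) by (auto simp: polynomial_map_def)
  have "F \<noteq> 0" using assms(2) by (auto simp: F)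
  then show ?thesis
    using assms(3) F unfolding generically_def by auto
qed

text \<open>
  The first twelve factors make the first-order operators shifting \<open>p\<close>, \<open>q\<close> and \<open>r\<close> invertible; the last
  three are leading coefficients of the operators shifting \<open>g\<close>.
\<close>

definition resonance :: "(param \<Rightarrow> complex) \<Rightarrow> complex" where
  "resonance v = (let a = v par_a; b = v par_b; c = v par_c; g = v par_g;
        p = v par_p; q = v par_q; r = v par_r
    in r * (r - 1) * (r - 2)
       * (2 * c + p + q + r + 1) * (a + b + 2 * c + g + p + q + r + 2)
       * (2 * a + 2 * b + 2 * c + g + p + q + r + 3)
       * (p + 1) * (a + c + p + 2) * (2 * a + 2 * c + g + p + 3)
       * (q + 1) * (b + c + q + 2) * (2 * b + 2 * c + g + q + 3)
       * (2 * a + 2 * b + 2 * c + 3 * g + 6) * (2 * b + g) * (a + c + g))"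

text \<open>The auxiliary shifts pass through integer translates of \<open>v\<close>, and
  \<open>resonance\<close> must not vanish along the way. The bound keeps the translates finite in
  number, so that a single product excludes them all; each shift uses up part of this
  margin.\<close>

definition nonresonant :: "nat \<Rightarrow> (param \<Rightarrow> complex) \<Rightarrow> bool" where
  "nonresonant n v \<longleftrightarrow>
     (\<forall>k :: param \<Rightarrow> int. (\<forall>i. \<bar>k i\<bar> \<le> int n) \<longrightarrow> resonance (\<lambda>i. v i + of_int (k i)) \<noteq> 0)"

lemma finite_UNIV_param: "finite (UNIV :: param set)"
proof -
  have "(UNIV :: param set) = {par_a, par_b, par_c, par_g, par_p, par_q, par_r}"
    using param.exhaust by blast
  then show ?thesis by (metis finite.emptyI finite.insertI)
qed

text \<open>
  All linear factors of the resonance polynomial have non-negative coefficients, so none of them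
  vanishes where every parameter has imaginary part 1; this set is stable under integer shifts.
\<close>

lemma generically_nonresonant: "generically (nonresonant n)"
proof (rule genericallyI)
  let ?K = "{k :: param \<Rightarrow> int. \<forall>i. \<bar>k i\<bar> \<le> int n}"
  let ?f = "\<lambda>v. \<Prod>k\<in>?K. resonance (\<lambda>i. v i + of_int (k i))"
  have fin: "finite ?K"
  proof (rule finite_subset)
    show "?K \<subseteq> {k. \<forall>i. (i \<in> UNIV \<longrightarrow> k i \<in> {- int n..int n}) \<and> (i \<notin> UNIV \<longrightarrow> k i = 0)}"
      by (auto simp: abs_le_iff minus_le_iff)
    show "finite \<dots>"
      by (rule finite_set_of_finite_funs) (simp_all add: finite_UNIV_param)
  qed
  show "polynomial_map ?f"
    unfolding resonance_def Let_def by (intro polynomial_map_prod polynomial_map_intros)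
  have nz: "x \<noteq> 0" if "Im x \<noteq> 0" for x
    using that by auto
  have "resonance (\<lambda>i. \<i> + of_int (k i)) \<noteq> 0" for k
    unfolding resonance_def Let_def mult_eq_0_iff de_Morgan_disj by (intro conjI nz) simp_all
  then show "?f (\<lambda>i. \<i>) \<noteq> 0"
    using fin by simp
  show "nonresonant n v" if "?f v \<noteq> 0" for v
    using that fin unfolding nonresonant_def by auto
qed

lemma nonresonant_mono: "nonresonant m v \<Longrightarrow> n \<le> m \<Longrightarrow> nonresonant n v"
  unfolding nonresonant_def by (meson of_nat_le_iff order_trans)

lemma nonresonantD: "nonresonant n v \<Longrightarrow> resonance v \<noteq> 0"
  unfolding nonresonant_def by (drule spec[of _ "\<lambda>_. 0"]) simp

lemma nonresonant_shift:
  assumes "nonresonant (m + n) v" "\<bar>d\<bar> \<le> int m"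
  shows "nonresonant n (shift_param i (of_int d) v)"
  unfolding nonresonant_def
proof (intro allI impI)
  fix k :: "param \<Rightarrow> int" assume k: "\<forall>i. \<bar>k i\<bar> \<le> int n"
  let ?k = "k(i := k i + d)"
  have "\<bar>?k j\<bar> \<le> int (m + n)" for j
    using k[rule_format, of j] assms(2) by (cases "j = i") auto
  then have "resonance (\<lambda>j. v j + of_int (?k j)) \<noteq> 0"
    using assms(1) by (simp add: nonresonant_def)
  also have "(\<lambda>j. v j + of_int (?k j)) = (\<lambda>j. shift_param i (of_int d) v j + of_int (k j))"
    by (auto simp: shift_param_def fun_eq_iff)
  finally show "resonance (\<lambda>j. shift_param i (of_int d) v j + of_int (k j)) \<noteq> 0" .
qed

subsection \<open>Equivalences shifting p, q and r\<close>

lemma degree_SE6_coeffs: "degree (SE6_coeffs v) \<le> 3"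
  by (simp add: SE6_coeffs_def Let_def)

lemma degree_coeff_SE6_coeffs: "degree (coeff (SE6_coeffs v) k) \<le> 3"
proof -
  have "degree (SE6_coeff0 a b c g q) \<le> 3" "degree (SE6_coeff1 a b c g q) \<le> 3"
    "degree (SE6_coeff2 a b c g q) \<le> 3" "degree (SE6_coeff3 a b c g q) \<le> 3" for a b c g q
    by (simp_all add: SE6_coeff0_def SE6_coeff1_def SE6_coeff2_def SE6_coeff3_def)
  then show ?thesis
    by (auto simp: SE6_coeffs_def Let_def coeff_pCons split: nat.split)
qed

text \<open>The polynomial is x^3 (x - 1)^3: the coefficients of w^3 in \<open>SE6_coeffs\<close>
  are 1, -3, 3, -1.\<close>

lemma coeff_SE6_top:
  "coeff (diffop_coeffs (SE6 v)) 6 = to_fract [:0, 0, 0, - 1, 3, - 3, 1:]"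
proof -
  have "coeff (diffop_coeffs (SE6 v)) (3 + 3)
      = ratfun_X ^ 6 - ratfun_const 3 * ratfun_X ^ 5 + ratfun_const 3 * ratfun_X ^ 4 - ratfun_X ^ 3"
    unfolding SE6_eq_conv_op coeff_conv_op_top[OF degree_coeff_SE6_coeffs]
    by (simp add: SE6_coeffs_def Let_def numeral_3_eq_3 SE6_coeff0_def SE6_coeff1_def SE6_coeff2_def SE6_coeff3_def)
       (simp add: eval_nat_numeral)
  also have "\<dots> = to_fract ([:0, 1:] ^ 6 - [:3:] * [:0, 1:] ^ 5 + [:3:] * [:0, 1:] ^ 4 - [:0, 1:] ^ 3)"
    by (simp add: ratfun_X_to_fract ratfun_const_to_fract eval_nat_numeral
        del: mult_pCons_left mult_pCons_right)
  also have "[:0, 1:] ^ 6 - [:3:] * [:0, 1:] ^ 5 + [:3:] * [:0, 1:] ^ 4 - [:0, 1:] ^ 3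
      = [:0, 0, 0, - 1, 3, - 3, 1 :: complex:]"
    by (simp add: eval_nat_numeral)
  finally show ?thesis by simp
qed

lemma diffop_order_SE6 [simp]: "diffop_order (SE6 v) = 6"
proof (rule diffop_order_eqI)
  show "diffop_order (SE6 v) \<le> 6"
    using diffop_order_conv_op_le[OF degree_coeff_SE6_coeffs, of 3] by (simp add: SE6_eq_conv_op)
qed (simp add: coeff_SE6_top)

text \<open>The constant is the value of \<open>SE6 v\<close> on the function 1: three factors come
  from F_0 at w = -(p + r), the other three from \<theta> - r, \<theta> - r + 1, \<theta> - r + 2 at
  \<theta> = 0.\<close>

lemma SE6_mod_ddx:
  assumes "resonance v \<noteq> 0"
  obtains A k where "SE6 v = A * ddx + cst k" "k \<noteq> 0"
proof -
  let ?k = "poly (coeff (SE6_coeffs v) 0) (- (v par_p + v par_r)) * (\<Prod>i<3. - v par_r + of_nat i)"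
  have "?k = (2 * v par_c + v par_p + v par_q + v par_r + 1)
      * (v par_a + v par_b + 2 * v par_c + v par_g + v par_p + v par_q + v par_r + 2)
      * (2 * v par_a + 2 * v par_b + 2 * v par_c + v par_g + v par_p + v par_q + v par_r + 3)
      * (v par_r * (v par_r - 1) * (v par_r - 2))"
    unfolding SE6_coeffs_def Let_def SE6_coeff0_def coeff_pCons_0 poly_mult poly_pCons poly_0
    by (simp add: numeral_3_eq_3 del: mult_eq_0_iff) algebra
  then have "?k \<noteq> 0"
    using assms by (simp add: resonance_def Let_def)
  moreover obtain A where "SE6 v = A * ddx + cst ?k"
    unfolding SE6_eq_conv_op using conv_op_factor_ddx by blast
  ultimately show ?thesis by (intro that)
qed

section \<open>Inverting the first-order operators modulo \<open>SE6\<close>\<close>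

lemma cst_inverse: "c \<noteq> 0 \<Longrightarrow> cst (1 / c) * cst c = 1"
  unfolding mult_op_mult[symmetric] ratfun_const_simps(6)[symmetric] by simp

text \<open>Neither p nor r occurs in \<open>SE6_coeffs\<close>, and \<partial> F(\<theta> + h) =
  F(\<theta> + h + 1) \<partial> matches the increase of h = -(p + r). So \<partial> itself serves
  as \<open>Q\<close>. The left inverse comes from dividing by the constant of
  \<open>SE6_mod_ddx\<close>.\<close>

lemma diffop_equiv_r:
  assumes "resonance v \<noteq> 0"
  shows "\<exists>Q. SE6 (shift_param par_r (- 1) v) * ddx = Q * SE6 v"
    and "diffop_equiv (SE6 v) (SE6 (shift_param par_r (- 1) v))"
proof -
  let ?w = "shift_param par_r (- 1) v"
  have ddx: "conv_op 1 u h [:0, 1:] = ddx" for u h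
    by (simp add: conv_op_def pcompose_1)
  have coeffs: "SE6_coeffs ?w = SE6_coeffs v"
    by (simp add: SE6_coeffs_def shift_param_def)
  have c01: "coeff [:0, 1 :: complex poly:] n = (if n = 1 then 1 else 0)" for n
    by (auto simp: coeff_pCons split: nat.split)
  have "conv_op 3 (- v par_r + of_nat 1) (- (v par_p + v par_r) + 1) (SE6_coeffs v)
        * conv_op 1 (- v par_r) (- (v par_p + v par_r)) [:0, 1:]
      = conv_op 1 (- v par_r + of_nat 3) (- (v par_p + v par_r)) [:0, 1:]
        * conv_op 3 (- v par_r) (- (v par_p + v par_r)) (SE6_coeffs v)"
  proof (rule conv_op_intertwine)
    fix n w
    have "n - i = Suc 0 \<longleftrightarrow> n \<ge> 1 \<and> i = n - 1" if "i \<le> n" for i using that by auto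
    then show "(\<Sum>i\<le>n. poly (coeff (SE6_coeffs v) i) (w + 1) * poly (coeff [:0, 1:] (n - i)) (w + of_nat i))
      = (\<Sum>i\<le>n. poly (coeff [:0, 1:] i) w * poly (coeff (SE6_coeffs v) (n - i)) (w + of_nat i))"
      unfolding c01 by (cases n) 
        (auto simp: if_distrib[of "\<lambda>p. poly p _"] if_distrib[of "\<lambda>x. _ * x"]
          if_distrib[of "\<lambda>x. x * _"] cong: if_cong)
  qed (simp_all add: degree_SE6_coeffs)
  moreover have "SE6 ?w = conv_op 3 (- v par_r + of_nat 1) (- (v par_p + v par_r) + 1) (SE6_coeffs v)"
    unfolding SE6_eq_conv_op coeffs by (simp add: shift_param_def algebra_simps)
  ultimately have 1: "SE6 ?w * ddx = ddx * SE6 v"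
    by (simp only: ddx SE6_eq_conv_op[of v, symmetric])
  then show "\<exists>Q. SE6 ?w * ddx = Q * SE6 v" by blast
  obtain A k where k: "SE6 v = A * ddx + cst k" "k \<noteq> 0"
    using SE6_mod_ddx[OF assms] by metis
  have inv: "cst (1 / k) * cst k = 1"
    using k(2) by (rule cst_inverse)
  have "- cst (1 / k) * A * ddx = 1 + (- cst (1 / k)) * SE6 v"
    by (simp add: k(1) distrib_left inv mult.assoc)
  then show "diffop_equiv (SE6 v) (SE6 ?w)"
    by (rule diffop_equivI[OF 1, where n = 6]) (simp_all add: diffop_order_def[of ddx] ddx_rep)
qed

text \<open>Each \<partial> lowers r by one, so the n inverses are taken at r, r - 1, ..., r - n +
  1. The case n = 3 serves the shifts of p and q, where division leaves a multiple of
  \<partial>^3.\<close>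

lemma ddx_pow_left_inverse:
  "nonresonant n v \<Longrightarrow> \<exists>Z S. Z * ddx ^ n = 1 + S * SE6 v"
proof (induction n arbitrary: v)
  case 0
  show ?case by (intro exI[of _ 1] exI[of _ 0]) simp
next
  case (Suc n)
  let ?w = "shift_param par_r (- 1) v"
  have "nonresonant n ?w"
    using nonresonant_shift[of 1 n v "- 1" par_r] Suc.prems by simp
  then obtain Z S where Z: "Z * ddx ^ n = 1 + S * SE6 ?w"
    using Suc.IH by blast
  have res: "resonance v \<noteq> 0" using Suc.prems by (rule nonresonantD)
  obtain Q where Q: "SE6 ?w * ddx = Q * SE6 v"
    using diffop_equiv_r(1)[OF res] by blast
  obtain A k where k: "SE6 v = A * ddx + cst k" "k \<noteq> 0"
    using SE6_mod_ddx[OF res] by metis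
  have inv: "cst (1 / k) * cst k = 1"
    using k(2) by (rule cst_inverse)
  define X where "X = - cst (1 / k) * A"
  have X: "X * ddx = 1 + (- cst (1 / k)) * SE6 v"
    by (simp add: X_def k(1) distrib_left inv mult.assoc)
  have "(X * Z) * ddx ^ Suc n = X * (Z * ddx ^ n) * ddx"
    by (simp add: mult.assoc power_commutes)
  also have "\<dots> = X * ddx + X * S * (SE6 ?w * ddx)"
    by (simp add: Z algebra_simps)
  also have "\<dots> = 1 + (- cst (1 / k) + X * S * Q) * SE6 v"
    by (simp add: X Q algebra_simps)
  finally show ?case by blast
qed

text \<open>Modulo \<open>SE6 v\<close> the product \<open>K * P\<close> is -c \<partial>^3;
  inverting \<partial>^3 from the left therefore inverts \<open>P\<close>.\<close>

lemma SE6_equivI: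
  assumes "F * P = Q * SE6 v" "diffop_order F = 6" "diffop_order P = 1"
    and c: "SE6 v = K * P + cst c * ddx ^ 3" "c \<noteq> 0" and res: "nonresonant 3 v"
  shows "diffop_equiv (SE6 v) F"
proof -
  obtain Z S where Z: "Z * ddx ^ 3 = 1 + S * SE6 v"
    using ddx_pow_left_inverse[OF res] by blast
  have inv: "cst (1 / c) * cst c = 1"
    using c(2) by (rule cst_inverse)
  have "- (Z * cst (1 / c) * K) * P = Z * (cst (1 / c) * cst c) * ddx ^ 3 - Z * cst (1 / c) * SE6 v"
    by (simp add: c(1) algebra_simps)
  also have "\<dots> = 1 + (S - Z * cst (1 / c)) * SE6 v"
    by (simp add: inv Z algebra_simps)
  finally show ?thesis
    by (rule diffop_equivI[OF assms(1), where n = 6]) (use assms(2,3) in simp_all)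
qed

text \<open>Padding with zero coefficients covers all \<open>d \<le> 4\<close> at once.\<close>

lemma conv_op_intertwine_list:
  fixes a0 a1 a2 a3 a0' a1' a2' a3' p0 p1 p2 p3 p4 q0 q1 q2 q3 q4 :: "complex poly"
  defines "P \<equiv> [:p0, p1, p2, p3, p4:]" and "Q \<equiv> [:q0, q1, q2, q3, q4:]"
  assumes deg: "degree P \<le> d" "degree Q \<le> d"
    and "\<And>w. poly a0' (w + s) * poly p0 w
      = poly q0 w * poly a0 w"
    and "\<And>w. poly a0' (w + s) * poly p1 w + poly a1' (w + s) * poly p0 (w + 1)
      = poly q0 w * poly a1 w + poly q1 w * poly a0 (w + 1)"
    and "\<And>w. poly a0' (w + s) * poly p2 w + poly a1' (w + s) * poly p1 (w + 1)
        + poly a2' (w + s) * poly p0 (w + 2)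
      = poly q0 w * poly a2 w + poly q1 w * poly a1 (w + 1) + poly q2 w * poly a0 (w + 2)"
    and "\<And>w. poly a0' (w + s) * poly p3 w + poly a1' (w + s) * poly p2 (w + 1)
        + poly a2' (w + s) * poly p1 (w + 2) + poly a3' (w + s) * poly p0 (w + 3)
      = poly q0 w * poly a3 w + poly q1 w * poly a2 (w + 1) + poly q2 w * poly a1 (w + 2)
        + poly q3 w * poly a0 (w + 3)"
    and "\<And>w. poly a0' (w + s) * poly p4 w + poly a1' (w + s) * poly p3 (w + 1)
        + poly a2' (w + s) * poly p2 (w + 2) + poly a3' (w + s) * poly p1 (w + 3)
      = poly q1 w * poly a3 (w + 1) + poly q2 w * poly a2 (w + 2) + poly q3 w * poly a1 (w + 3)
        + poly q4 w * poly a0 (w + 4)"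
    and "\<And>w. poly a1' (w + s) * poly p4 (w + 1) + poly a2' (w + s) * poly p3 (w + 2)
        + poly a3' (w + s) * poly p2 (w + 3)
      = poly q2 w * poly a3 (w + 2) + poly q3 w * poly a2 (w + 3) + poly q4 w * poly a1 (w + 4)"
    and "\<And>w. poly a2' (w + s) * poly p4 (w + 2) + poly a3' (w + s) * poly p3 (w + 3)
      = poly q3 w * poly a3 (w + 3) + poly q4 w * poly a2 (w + 4)"
    and "\<And>w. poly a3' (w + s) * poly p4 (w + 3)
      = poly q4 w * poly a3 (w + 4)"
  shows "conv_op 3 (u + of_nat d) (h + s) [:a0', a1', a2', a3':] * conv_op d u h P
    = conv_op d (u + 3) h Q * conv_op 3 u h [:a0, a1, a2, a3:]"
proof -
  have "conv_op 3 (u + of_nat d) (h + s) [:a0', a1', a2', a3':] * conv_op d u h P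
    = conv_op d (u + of_nat 3) h Q * conv_op 3 u h [:a0, a1, a2, a3:]"
  proof (rule conv_op_intertwine)
    fix n :: nat and w
    consider "n = 0" | "n = 1" | "n = 2" | "n = 3" | "n = 4" | "n = 5" | "n = 6" | "n = 7" | "n \<ge> 8"
      by linarith
    then show "(\<Sum>i\<le>n. poly (coeff [:a0', a1', a2', a3':] i) (w + s) * poly (coeff P (n - i)) (w + of_nat i))
      = (\<Sum>i\<le>n. poly (coeff Q i) w * poly (coeff [:a0, a1, a2, a3:] (n - i)) (w + of_nat i))"
    proof cases
      \<comment> \<open>This is n \<ge> 8, beyond the total degree 3 + 4 in y.\<close>
      case 9
      have z: "coeff [:a0', a1', a2', a3':] i = 0 \<or> coeff P (n - i) = 0"
        "coeff Q i = 0 \<or> coeff [:a0, a1, a2, a3:] (n - i) = 0" if "i \<le> n" for i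
        using that 9 by (auto simp: P_def Q_def coeff_pCons split: nat.splits)
      show ?thesis using z by (intro sum.neutral[THEN trans] sum.neutral[symmetric]) force+
    qed (use assms(5-)[of w] in \<open>simp_all add: P_def Q_def eval_nat_numeral add_ac\<close>)
  qed (use deg in \<open>simp_all add: degree_pCons_eq_if\<close>)
  then show ?thesis by simp
qed

text \<open>Raising p and lowering r leaves h = -(p + r) unchanged, and \<theta> - r belongs to the
  constant 1 in the skew ring, so the same coefficients serve on both sides.\<close>

lemma diffop_equiv_p:
  assumes res: "nonresonant 3 v"
  shows "diffop_equiv (SE6 v) (SE6 (shift_param par_r (- 1) (shift_param par_p 1 v)))"
    (is "diffop_equiv _ (SE6 ?w)")
proof -
  define u h where "u = - v par_r" and "h = - (v par_p + v par_r)"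
  obtain f0 f1 f2 f3 where f: "SE6_coeffs v = [:f0, f1, f2, f3:]"
    and f3: "f3 = SE6_coeff3 (v par_a) (v par_b) (v par_c) (v par_g) (v par_q)"
    by (simp add: SE6_coeffs_def Let_def)
  have E: "SE6 v = conv_op 3 u h [:f0, f1, f2, f3:]"
    by (simp add: SE6_eq_conv_op f u_def h_def)
  have "SE6_coeffs ?w = SE6_coeffs v"
    by (simp add: SE6_coeffs_def shift_param_def)
  then have F: "SE6 ?w = conv_op 3 (u + of_nat 1) (h + 0) [:f0, f1, f2, f3:]"
    by (simp add: SE6_eq_conv_op f u_def h_def shift_param_def algebra_simps)
  define P where "P = theta_poly [:u, 1:]"
  have P: "conv_op 1 u h [:1, 0:] = P"
    by (simp add: conv_op_def P_def pcompose_1)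
  have "SE6 ?w * P = conv_op 1 (u + 3) h [:1, 0:] * SE6 v"
  proof -
    have P': "P = conv_op 1 u h [:1, 0, 0, 0, 0:]" "[:1, 0:] = [:1, 0, 0, 0, 0 :: complex poly:]"
      by (simp_all add: P[symmetric])
    show ?thesis
      unfolding E F P'
      by (rule conv_op_intertwine_list) simp_all
  qed
  moreover have "diffop_order P = 1"
  proof (rule diffop_order_eqI)
    show "diffop_order P \<le> 1" unfolding P_def by (rule diffop_order_theta_poly_le) simp
    show "coeff (diffop_coeffs P) 1 \<noteq> 0"
      unfolding P_def by (subst coeff_theta_poly_top) (simp_all add: ratfun_X_to_fract)
  qed
  \<comment> \<open>For k < 3 the k-th summand contains \<theta> + u + k, which passes
    \<open>ddx ^ k\<close> and becomes \<open>P\<close>. Only k = 3 lacks this factor; dividing F_3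
    by \<theta> + u + 3 leaves its value at w = h - u - 3 = -p - 3.\<close>
  moreover obtain K where "SE6 v = K * P + cst (poly f3 (h - u - 3)) * ddx ^ 3"
  proof -
    have move: "theta_poly (g * [:u + of_nat k, 1:]) * ddx ^ k = theta_poly g * ddx ^ k * P" for g k
    proof -
      have "[:u, 1:] \<circ>\<^sub>p [:of_nat k, 1:] = [:u + of_nat k, 1:]"
        by (simp add: pcompose_pCons add.commute)
      then have "ddx ^ k * P = theta_poly [:u + of_nat k, 1:] * ddx ^ k"
        by (simp only: P_def ddx_pow_theta_poly)
      then show ?thesis
        by (simp only: theta_poly_mult mult.assoc)
    qed
    have "poly (f3 \<circ>\<^sub>p [:h, 1:] - [:poly f3 (h - u - 3):]) (- (u + 3)) = 0"
      by (simp add: poly_pcompose algebra_simps)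
    then obtain g where "f3 \<circ>\<^sub>p [:h, 1:] - [:poly f3 (h - u - 3):] = [:u + 3, 1:] * g"
      unfolding poly_eq_0_iff_dvd minus_minus by (rule dvdE)
    then have g: "f3 \<circ>\<^sub>p [:h, 1:] = g * [:u + 3, 1:] + [:poly f3 (h - u - 3):]"
      by (metis diff_eq_eq mult.commute)
    have "SE6 v = theta_poly ((f0 \<circ>\<^sub>p [:h, 1:]) * ([:u + 1, 1:] * [:u + 2, 1:]) * [:u + of_nat 0, 1:]) * ddx ^ 0
        + theta_poly ((f1 \<circ>\<^sub>p [:h, 1:]) * [:u + 2, 1:] * [:u + of_nat 1, 1:]) * ddx ^ 1
        + theta_poly ((f2 \<circ>\<^sub>p [:h, 1:]) * [:u + of_nat 2, 1:]) * ddx ^ 2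
        + theta_poly (g * [:u + of_nat 3, 1:]) * ddx ^ 3 + cst (poly f3 (h - u - 3)) * ddx ^ 3"
    proof -
      have swap: "f * (x * y * z) = f * (y * z) * x" "f * (x * y) = f * y * x" for f x y z :: "complex poly"
        by (simp_all only: mult_ac)
      have one: "u + of_nat 1 = u + 1" "u + of_nat 2 = u + 2" "u + of_nat 3 = u + 3" "u + of_nat 0 = u"
        by simp_all
      show ?thesis
        unfolding E conv_op_3 g one theta_poly_add theta_poly_const distrib_right power_0 power_one_right mult_1_right
        by (subst swap(1), subst swap(2)) (simp only: add.assoc)
    qed
    also have "\<dots> = (theta_poly ((f0 \<circ>\<^sub>p [:h, 1:]) * ([:u + 1, 1:] * [:u + 2, 1:])) * ddx ^ 0
        + theta_poly ((f1 \<circ>\<^sub>p [:h, 1:]) * [:u + 2, 1:]) * ddx ^ 1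
        + theta_poly (f2 \<circ>\<^sub>p [:h, 1:]) * ddx ^ 2 + theta_poly g * ddx ^ 3) * P
        + cst (poly f3 (h - u - 3)) * ddx ^ 3"
      by (simp only: move distrib_right)
    finally show ?thesis by (rule that)
  qed
  moreover have "poly f3 (h - u - 3) \<noteq> 0"
  proof -
    have "poly f3 (h - u - 3) = (v par_p + 1) * (v par_a + v par_c + v par_p + 2)
        * (2 * v par_a + 2 * v par_c + v par_g + v par_p + 3)"
      unfolding f3 SE6_coeff3_def u_def h_def poly_mult poly_minus poly_pCons poly_0 by algebra
    then show ?thesis
      using nonresonantD[OF res] by (simp add: resonance_def Let_def)
  qed
  ultimately show ?thesis
    using res by (intro SE6_equivI) simp_all
qed

text \<open>Here \<open>P\<close> is (x - 1) \<partial> - r, which belongs to 1 - y. Unlike p, the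
  parameter q occurs in the coefficients, so the intertwining consists of genuine identities between
  them.\<close>

lemma diffop_equiv_q:
  assumes res: "nonresonant 3 v"
  shows "diffop_equiv (SE6 v) (SE6 (shift_param par_r (- 1) (shift_param par_q 1 v)))"
    (is "diffop_equiv _ (SE6 ?w)")
proof -
  define u h where "u = - v par_r" and "h = - (v par_p + v par_r)"
  define a b c g q where abc: "a = v par_a" "b = v par_b" "c = v par_c" "g = v par_g" "q = v par_q"
  define f0 f1 f2 f3 where f_def: "f0 = SE6_coeff0 a b c g q" "f1 = SE6_coeff1 a b c g q"
    "f2 = SE6_coeff2 a b c g q" "f3 = SE6_coeff3 a b c g q"
  define k where "k = - ((q + 1) * (b + c + q + 2) * (2 * b + 2 * c + g + q + 3))"
  have E: "SE6 v = conv_op 3 u h [:f0, f1, f2, f3:]"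
    by (simp add: SE6_eq_conv_op SE6_coeffs_def Let_def u_def h_def abc f_def)
  have F: "SE6 ?w = conv_op 3 (u + of_nat 1) (h + 1) [:SE6_coeff0 a b c g (q + 1), SE6_coeff1 a b c g (q + 1),
      SE6_coeff2 a b c g (q + 1), SE6_coeff3 a b c g (q + 1):]"
    by (simp add: SE6_eq_conv_op SE6_coeffs_def Let_def u_def h_def abc shift_param_def algebra_simps)
  define P where "P = conv_op 1 u h [:1, - 1:]"
  have "SE6 ?w * P = conv_op 1 (u + 3) h [:1, - 1:] * SE6 v"
  proof -
    have P': "P = conv_op 1 u h [:1, - 1, 0, 0, 0:]" "[:1, - 1:] = [:1, - 1, 0, 0, 0 :: complex poly:]"
      by (simp_all add: P_def)
    show ?thesis
      unfolding E F P'
      by (rule conv_op_intertwine_list, simp, simp)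
        (unfold f_def SE6_coeff0_def SE6_coeff1_def SE6_coeff2_def SE6_coeff3_def
            poly_mult poly_minus poly_pCons poly_0 poly_1, algebra+)
  qed
  moreover have "diffop_order P = 1"
  proof (rule diffop_order_eqI)
    have deg: "degree (coeff [:1, - 1 :: complex poly:] k) \<le> 0" for k
      by (auto simp: coeff_pCons split: nat.split)
    show "diffop_order P \<le> 1"
      using diffop_order_conv_op_le[OF deg, of 1 u h] by (simp add: P_def)
    have "coeff (diffop_coeffs P) 1 = ratfun_X - 1"
      using coeff_conv_op_top[OF deg, of 1 u h] by (simp add: P_def)
    also have "\<dots> = to_fract [:- 1, 1:]"
      by (simp add: ratfun_X_to_fract one_pCons flip: to_fract_1 to_fract_diff)
    finally show "coeff (diffop_coeffs P) 1 \<noteq> 0" by simp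
  qed
  \<comment> \<open>Division by 1 - y telescopes: the quotient has the partial sums of the F_k as
    coefficients, and the remainder is their total sum times y^3. In this sum all positive powers of
    w cancel.\<close>
  moreover have "SE6 v = conv_op 2 (u + 1) h [:f0, f0 + f1, f0 + f1 + f2:] * P + cst k * ddx ^ 3"
  proof -
    have k: "f0 + f1 + f2 + f3 = [:k:]"
      by (rule poly_eq_poly_eq_iff[THEN iffD1], rule ext,
          unfold f_def k_def SE6_coeff0_def SE6_coeff1_def SE6_coeff2_def SE6_coeff3_def
          poly_mult poly_minus poly_add poly_pCons poly_0) algebra
    have f3: "f3 = - (f0 + f1 + f2) + [:k:]" by (simp flip: k)
    have "conv_op 2 (u + of_nat 1) (h + 0) [:f0, f0 + f1, f0 + f1 + f2:] * P
      = conv_op (2 + 1) u h [:f0, f1, f2, - (f0 + f1 + f2):]"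
      unfolding P_def
    proof (rule conv_op_multI)
      fix n :: nat and w assume "n \<le> 2 + 1"
      then consider "n = 0" | "n = 1" | "n = 2" | "n = 3" by linarith
      then show "(\<Sum>i\<le>n. poly (coeff [:f0, f0 + f1, f0 + f1 + f2:] i) (w + 0) * poly (coeff [:1, - 1:] (n - i)) (w + of_nat i))
        = poly (coeff [:f0, f1, f2, - (f0 + f1 + f2):] n) w"
        by cases (simp_all add: eval_nat_numeral)
    qed (simp_all add: degree_pCons_eq_if)
    then have KP: "conv_op 2 (u + 1) h [:f0, f0 + f1, f0 + f1 + f2:] * P
      = conv_op 3 u h [:f0, f1, f2, - (f0 + f1 + f2):]"
      by simp
    show ?thesis
      unfolding E KP conv_op_3 f3
      by (simp only: pcompose_add pcompose_const theta_poly_add theta_poly_const distrib_right add.assoc)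
  qed
  moreover have "k \<noteq> 0"
    using nonresonantD[OF res] by (simp add: resonance_def Let_def k_def abc)
  ultimately show ?thesis
    using res by (intro SE6_equivI) simp_all
qed

text \<open>For d < 4 the order is too small. For d = 4 the factor \<open>S\<close> has order 0, and
  it is a constant because both sides have constant terms free of x, that of \<open>SE6 v\<close>
  being nonzero. The top coefficient would then be a multiple of x^3 (x - 1)^3, but its x^2
  coefficient is that of w^2 in the d-th coefficient polynomial.\<close>

lemma not_left_multiple_SE6:
  assumes "d \<le> 4" and deg: "\<And>k. degree (coeff P k) \<le> 2" and top: "coeff (coeff P d) 2 \<noteq> 0"
    and res: "resonance v \<noteq> 0"
  shows "conv_op d u h P \<noteq> S * SE6 v"
proof
  assume eq: "conv_op d u h P = S * SE6 v"
  define t where "t = (\<Sum>k\<le>d. monom (coeff (coeff P k) 2) (d + 2 - k))"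
  have X_pow: "ratfun_X ^ m = to_fract (monom 1 m)" for m
    by (induction m) (simp_all add: ratfun_X_to_fract monom_Suc flip: to_fract_mult)
  have to_fract_sum: "to_fract (sum f I) = (\<Sum>i\<in>I. to_fract (f i))" for f :: "nat \<Rightarrow> complex poly" and I
    by (induction I rule: infinite_finite_induct) simp_all
  have ct: "coeff (diffop_coeffs (conv_op d u h P)) (d + 2) = to_fract t"
    unfolding coeff_conv_op_top[OF deg] t_def to_fract_sum X_pow ratfun_const_to_fract
    by (intro sum.cong refl) (simp add: smult_monom flip: to_fract_mult)
  have "coeff t 2 = (\<Sum>k\<le>d. if k = d then coeff (coeff P k) 2 else 0)"
    unfolding t_def coeff_sum by (intro sum.cong) auto
  then have t2: "coeff t 2 \<noteq> 0" using top by simp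
  then have nz: "conv_op d u h P \<noteq> 0" using ct by auto
  then have "diffop_order S + 6 = diffop_order (conv_op d u h P)"
    using diffop_order_left_multiple[OF eq] by simp
  also have "\<dots> \<le> d + 2" by (rule diffop_order_conv_op_le[OF deg])
  finally have "d = 4" "diffop_order S = 0" using \<open>d \<le> 4\<close> by simp_all
  then obtain w where w: "S = mult_op w" by (metis diffop_order_0E)
  obtain k A where k: "SE6 v = A * ddx + cst k" "k \<noteq> 0"
    using SE6_mod_ddx[OF res] by metis
  have "ratfun_const (poly (coeff P 0) h * (\<Prod>i<d. u + of_nat i)) = w * ratfun_const k"
    using arg_cong[OF eq, of "\<lambda>A. coeff (diffop_coeffs A) 0"]
    by (simp add: coeff_0_conv_op w coeff_mult_op_times k(1) coeff_times_ddx mult_op_rep)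
  then have "w = ratfun_const (poly (coeff P 0) h * (\<Prod>i<d. u + of_nat i)) / ratfun_const k"
    using k(2) by simp
  also have "\<dots> = ratfun_const (poly (coeff P 0) h * (\<Prod>i<d. u + of_nat i) / k)"
    using k(2) by (simp add: divide_eq_eq flip: ratfun_const_simps(6))
  finally obtain e where e: "w = ratfun_const e" by blast
  have "to_fract t = to_fract ([:e:] * [:0, 0, 0, - 1, 3, - 3, 1:])"
    using arg_cong[OF eq, of "\<lambda>A. coeff (diffop_coeffs A) 6"] ct \<open>d = 4\<close>
    by (simp add: w coeff_mult_op_times coeff_SE6_top e ratfun_const_to_fract flip: to_fract_mult)
  then have "t = [:e:] * [:0, 0, 0, - 1, 3, - 3, 1:]" by (simp only: to_fract_eq_iff)
  with t2 show False by (simp add: numeral_2_eq_2)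
qed

text \<open>The composition rule makes r drop by exactly the degree d in y. The shift m of p acts
  only through h, which moves by s = d - m. The eight identities are those for y^0 to y^7.\<close>

lemma SE6_has_morphism:
  fixes p\<^sub>0 p\<^sub>1 p\<^sub>2 p\<^sub>3 p\<^sub>4 q\<^sub>0 q\<^sub>1 q\<^sub>2 q\<^sub>3 q\<^sub>4 :: "complex poly"
  defines "P \<equiv> [:p\<^sub>0, p\<^sub>1, p\<^sub>2, p\<^sub>3, p\<^sub>4:]" and "Q \<equiv> [:q\<^sub>0, q\<^sub>1, q\<^sub>2, q\<^sub>3, q\<^sub>4:]"
  assumes top: "coeff (coeff P d) 2 \<noteq> 0"
    and v': "v' par_p = v par_p + m" "v' par_r = v par_r - of_nat d" "s = of_nat d - m"
    and coeffs: "SE6_coeffs v = [:a\<^sub>0, a\<^sub>1, a\<^sub>2, a\<^sub>3:]" "SE6_coeffs v' = [:a0', a1', a2', a3':]"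
    and deg: "degree P \<le> d" "degree Q \<le> d" "d \<le> 4"
      "degree p\<^sub>0 \<le> 2" "degree p\<^sub>1 \<le> 2" "degree p\<^sub>2 \<le> 2" "degree p\<^sub>3 \<le> 2" "degree p\<^sub>4 \<le> 2"
    and res: "resonance v \<noteq> 0"
    and "\<And>w. poly a0' (w + s) * poly p\<^sub>0 w
      = poly q\<^sub>0 w * poly a\<^sub>0 w"
    and "\<And>w. poly a0' (w + s) * poly p\<^sub>1 w + poly a1' (w + s) * poly p\<^sub>0 (w + 1)
      = poly q\<^sub>0 w * poly a\<^sub>1 w + poly q\<^sub>1 w * poly a\<^sub>0 (w + 1)"
    and "\<And>w. poly a0' (w + s) * poly p\<^sub>2 w + poly a1' (w + s) * poly p\<^sub>1 (w + 1)
        + poly a2' (w + s) * poly p\<^sub>0 (w + 2)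
      = poly q\<^sub>0 w * poly a\<^sub>2 w + poly q\<^sub>1 w * poly a\<^sub>1 (w + 1) + poly q\<^sub>2 w * poly a\<^sub>0 (w + 2)"
    and "\<And>w. poly a0' (w + s) * poly p\<^sub>3 w + poly a1' (w + s) * poly p\<^sub>2 (w + 1)
        + poly a2' (w + s) * poly p\<^sub>1 (w + 2) + poly a3' (w + s) * poly p\<^sub>0 (w + 3)
      = poly q\<^sub>0 w * poly a\<^sub>3 w + poly q\<^sub>1 w * poly a\<^sub>2 (w + 1) + poly q\<^sub>2 w * poly a\<^sub>1 (w + 2)
        + poly q\<^sub>3 w * poly a\<^sub>0 (w + 3)"
    and "\<And>w. poly a0' (w + s) * poly p\<^sub>4 w + poly a1' (w + s) * poly p\<^sub>3 (w + 1)
        + poly a2' (w + s) * poly p\<^sub>2 (w + 2) + poly a3' (w + s) * poly p\<^sub>1 (w + 3)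
      = poly q\<^sub>1 w * poly a\<^sub>3 (w + 1) + poly q\<^sub>2 w * poly a\<^sub>2 (w + 2) + poly q\<^sub>3 w * poly a\<^sub>1 (w + 3)
        + poly q\<^sub>4 w * poly a\<^sub>0 (w + 4)"
    and "\<And>w. poly a1' (w + s) * poly p\<^sub>4 (w + 1) + poly a2' (w + s) * poly p\<^sub>3 (w + 2)
        + poly a3' (w + s) * poly p\<^sub>2 (w + 3)
      = poly q\<^sub>2 w * poly a\<^sub>3 (w + 2) + poly q\<^sub>3 w * poly a\<^sub>2 (w + 3) + poly q\<^sub>4 w * poly a\<^sub>1 (w + 4)"
    and "\<And>w. poly a2' (w + s) * poly p\<^sub>4 (w + 2) + poly a3' (w + s) * poly p\<^sub>3 (w + 3)
      = poly q\<^sub>3 w * poly a\<^sub>3 (w + 3) + poly q\<^sub>4 w * poly a\<^sub>2 (w + 4)"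
    and "\<And>w. poly a3' (w + s) * poly p\<^sub>4 (w + 3)
      = poly q\<^sub>4 w * poly a\<^sub>3 (w + 4)"
  shows "has_morphism (SE6 v) (SE6 v')"
proof -
  let ?u = "- v par_r" and ?h = "- (v par_p + v par_r)"
  have E: "SE6 v = conv_op 3 ?u ?h [:a\<^sub>0, a\<^sub>1, a\<^sub>2, a\<^sub>3:]"
    by (simp add: SE6_eq_conv_op coeffs)
  have E': "SE6 v' = conv_op 3 (?u + of_nat d) (?h + s) [:a0', a1', a2', a3':]"
    by (simp add: SE6_eq_conv_op coeffs v' algebra_simps)
  have "SE6 v' * conv_op d ?u ?h P = conv_op d (?u + 3) ?h Q * SE6 v"
    unfolding E E' P_def Q_def
    using deg(1,2) assms(16-) unfolding P_def Q_def by (intro conv_op_intertwine_list) simp_all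
  moreover have "degree (coeff P k) \<le> 2" for k
    using deg(4-) by (auto simp: P_def coeff_pCons split: nat.split)
  then have "conv_op d ?u ?h P \<noteq> S * SE6 v" for S
    by (intro not_left_multiple_SE6) (use deg(3) top res in simp_all)
  ultimately show ?thesis
    unfolding has_morphism_def by blast
qed

subsection \<open>Morphisms shifting a, b, c and g\<close>

text \<open>
  The coefficients of the operators \<open>P\<close> and \<open>Q\<close> below are the solutions, unique up to scaling, of the
  linear system given by the intertwining relation for an ansatz with quadratic \<open>p\<^sub>i\<close> and \<open>q\<^sub>i\<close>.
\<close>

lemma SE6_morphism_a_plus:
  assumes res: "resonance v \<noteq> 0"
  shows "has_morphism (SE6 v)
    (SE6 (shift_param par_r (- 2) (shift_param par_a 1 v)))"
proof -
  define a b c g q where abc: "a = v par_a" "b = v par_b" "c = v par_c" "g = v par_g"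
    "q = v par_q"
  \<comment> \<open>Apart from the leading coefficient and fourteen conditions on parameters and
    degrees, only the eight identities remain; they involve a, b, c, g, q and w alone.\<close>
  show ?thesis
    by (rule SE6_has_morphism[where d = 2 and m = 0 and s = 2 and
          p\<^sub>0 = "[:2 * a * c + a * q + 2 * b * c + b * q + 4 * c^2 + 2 * c * g + 4 * c * q + g * q
              + q^2 + a + b + 6 * c + g + 3 * q + 2,
              - a - b - 4 * c - g - 2 * q - 3,
              1:]" and
          p\<^sub>1 = "[:- 6 * a * c - 3 * a * q - 2 * b * c - 6 * c^2 - 3 * c * g - 3 * c * q - g * q
              - 6 * c - 2 * q,
              4 * a + b + 7 * c + 2 * g + 2 * q + 4,
              - 2:]" and
          p\<^sub>2 = "[:2 * a^2 + 4 * a * c + a * g + 2 * c^2 + c * g + a + c, - 3 * a - 3 * c - g - 1, 1:]" and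
          p\<^sub>3 = 0 and
          p\<^sub>4 = 0 and
          q\<^sub>0 = "[:2 * a * c + a * q + 2 * b * c + b * q + 4 * c^2 + 2 * c * g + 4 * c * q + g * q
              + q^2 - a - b - g - 1,
              - a - b - 4 * c - g - 2 * q,
              1:]" and
          q\<^sub>1 = "[:- 6 * a * c - 3 * a * q - 2 * b * c - 6 * c^2 - 3 * c * g - 3 * c * q - g * q
              + 7 * a + 2 * b + 5 * c + 4 * g + q + 3,
              4 * a + b + 7 * c + 2 * g + 2 * q - 2,
              - 2:]" and
          q\<^sub>2 = "[:2 * a^2 + 4 * a * c + a * g + 2 * c^2 + c * g - 4 * a - 4 * c - 2 * g,
              - 3 * a - 3 * c - g + 2,
              1:]" and
          q\<^sub>3 = 0 and
          q\<^sub>4 = 0 and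
          a\<^sub>0 = "SE6_coeff0 a b c g q" and a0' = "SE6_coeff0 (a + 1) b c g q" and
          a\<^sub>1 = "SE6_coeff1 a b c g q" and a1' = "SE6_coeff1 (a + 1) b c g q" and
          a\<^sub>2 = "SE6_coeff2 a b c g q" and a2' = "SE6_coeff2 (a + 1) b c g q" and
          a\<^sub>3 = "SE6_coeff3 a b c g q" and a3' = "SE6_coeff3 (a + 1) b c g q"],
        simp add: eval_nat_numeral,
        (simp_all add: abc shift_param_def SE6_coeffs_def Let_def res)[14])
      (unfold SE6_coeff0_def SE6_coeff1_def SE6_coeff2_def SE6_coeff3_def
         poly_mult poly_minus poly_pCons poly_0, algebra+)
qed

text \<open>The outermost identities dictate the auxiliary shifts. A nonzero quadratic
  \<open>p\<^sub>0\<close> is not divisible by the cubic \<open>a\<^sub>0\<close>, so the first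
  identity needs a common root of \<open>a\<^sub>0\<close> and the shifted \<open>a0'\<close>: one
  of e_7, e_8, e_9 stays fixed. At the other end, one of e_1, e_2, e_3 falls by d. Here p + 2 keeps
  e_7 fixed while e_3 falls by 2; with r - 2 alone, e_7, e_8, e_9 would all rise.\<close>

lemma SE6_morphism_a_minus:
  assumes res: "resonance v \<noteq> 0"
  shows "has_morphism (SE6 v)
    (SE6 (shift_param par_r (- 2) (shift_param par_p 2 (shift_param par_a (- 1) v))))"
proof -
  define a b c g q where abc: "a = v par_a" "b = v par_b" "c = v par_c" "g = v par_g"
    "q = v par_q"
  show ?thesis
    by (rule SE6_has_morphism[where d = 2 and m = 2 and s = 0 and
          p\<^sub>0 = "[:2 * a^2 + 4 * a * b + 6 * a * c + 3 * a * g + 3 * a * q + 2 * b^2 + 6 * b * c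
              + 3 * b * g + 3 * b * q + 4 * c^2 + 4 * c * g + 4 * c * q + g^2 + 2 * g * q + q^2
              + 7 * a + 7 * b + 10 * c + 5 * g + 5 * q + 6,
              - 3 * a - 3 * b - 4 * c - 2 * g - 2 * q - 5,
              1:]" and
          p\<^sub>1 = "[:- 2 * a * c - a * q - 2 * b * c - 2 * c^2 - c * g - c * q - 2 * c,
              4 * a + 3 * b + 5 * c + 2 * g + 2 * q + 4,
              - 2:]" and
          p\<^sub>2 = "[:- a - c, - a - c + 1, 1:]" and
          p\<^sub>3 = 0 and
          p\<^sub>4 = 0 and
          q\<^sub>0 = "[:2 * a^2 + 4 * a * b + 6 * a * c + 3 * a * g + 3 * a * q + 2 * b^2 + 6 * b * c
              + 3 * b * g + 3 * b * q + 4 * c^2 + 4 * c * g + 4 * c * q + g^2 + 2 * g * q + q^2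
              + 3 * a + 3 * b + 4 * c + 2 * g + 2 * q + 1,
              - 3 * a - 3 * b - 4 * c - 2 * g - 2 * q - 2,
              1:]" and
          q\<^sub>1 = "[:- 2 * a * c - a * q - 2 * b * c - 2 * c^2 - c * g - c * q + 5 * a + 4 * b + 5 * c
              + 3 * g + 3 * q + 1,
              4 * a + 3 * b + 5 * c + 2 * g + 2 * q - 2,
              - 2:]" and
          q\<^sub>2 = "[:- 2 * a - 2 * c + 4, - a - c + 4, 1:]" and
          q\<^sub>3 = 0 and
          q\<^sub>4 = 0 and
          a\<^sub>0 = "SE6_coeff0 a b c g q" and a0' = "SE6_coeff0 (a - 1) b c g q" and
          a\<^sub>1 = "SE6_coeff1 a b c g q" and a1' = "SE6_coeff1 (a - 1) b c g q" and
          a\<^sub>2 = "SE6_coeff2 a b c g q" and a2' = "SE6_coeff2 (a - 1) b c g q" and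
          a\<^sub>3 = "SE6_coeff3 a b c g q" and a3' = "SE6_coeff3 (a - 1) b c g q"],
        simp add: eval_nat_numeral,
        (simp_all add: abc shift_param_def SE6_coeffs_def Let_def res)[14])
      (unfold SE6_coeff0_def SE6_coeff1_def SE6_coeff2_def SE6_coeff3_def
         poly_mult poly_minus poly_pCons poly_0, algebra+)
qed

lemma SE6_morphism_b_plus:
  assumes res: "resonance v \<noteq> 0"
  shows "has_morphism (SE6 v)
    (SE6 (shift_param par_r (- 2) (shift_param par_b 1 v)))"
proof -
  define a b c g q where abc: "a = v par_a" "b = v par_b" "c = v par_c" "g = v par_g"
    "q = v par_q"
  show ?thesis
    by (rule SE6_has_morphism[where d = 2 and m = 0 and s = 2 and
          p\<^sub>0 = "[:2 * a * c + a * q + 2 * b * c + b * q + 4 * c^2 + 2 * c * g + 4 * c * q + g * q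
              + q^2 + a + b + 6 * c + g + 3 * q + 2,
              - a - b - 4 * c - g - 2 * q - 3,
              1:]" and
          p\<^sub>1 = "[:- 2 * a * c - a * q + 2 * b * c + 2 * b * q - 2 * c^2 - c * g - c * q + 2 * c
              + 2 * q,
              2 * a - b + 5 * c + g + 2 * q,
              - 2:]" and
          p\<^sub>2 = "[:2 * b^2 + b * g - a + 6 * b - c + g + 4, - a + 2 * b - c + 3, 1:]" and
          p\<^sub>3 = 0 and
          p\<^sub>4 = 0 and
          q\<^sub>0 = "[:2 * a * c + a * q + 2 * b * c + b * q + 4 * c^2 + 2 * c * g + 4 * c * q + g * q
              + q^2 - a - b - g - 1,
              - a - b - 4 * c - g - 2 * q,
              1:]" and
          q\<^sub>1 = "[:- 2 * a * c - a * q + 2 * b * c + 2 * b * q - 2 * c^2 - c * g - c * q + 5 * a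
              + 15 * c + 3 * g + 8 * q - 6,
              2 * a - b + 5 * c + g + 2 * q - 9,
              - 2:]" and
          q\<^sub>2 = "[:2 * b^2 + b * g - 4 * a + 12 * b - 4 * c + g + 22, - a + 2 * b - c + 9, 1:]" and
          q\<^sub>3 = 0 and
          q\<^sub>4 = 0 and
          a\<^sub>0 = "SE6_coeff0 a b c g q" and a0' = "SE6_coeff0 a (b + 1) c g q" and
          a\<^sub>1 = "SE6_coeff1 a b c g q" and a1' = "SE6_coeff1 a (b + 1) c g q" and
          a\<^sub>2 = "SE6_coeff2 a b c g q" and a2' = "SE6_coeff2 a (b + 1) c g q" and
          a\<^sub>3 = "SE6_coeff3 a b c g q" and a3' = "SE6_coeff3 a (b + 1) c g q"],
        simp add: eval_nat_numeral,
        (simp_all add: abc shift_param_def SE6_coeffs_def Let_def res)[14])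
      (unfold SE6_coeff0_def SE6_coeff1_def SE6_coeff2_def SE6_coeff3_def
         poly_mult poly_minus poly_pCons poly_0, algebra+)
qed

text \<open>Now q + 2 fixes e_7, while e_1, e_2, e_3, which contain neither b nor q, fall by 2 with
  r. Raising p instead would leave these three unchanged.\<close>

lemma SE6_morphism_b_minus:
  assumes res: "resonance v \<noteq> 0"
  shows "has_morphism (SE6 v)
    (SE6 (shift_param par_r (- 2) (shift_param par_q 2 (shift_param par_b (- 1) v))))"
proof -
  define a b c g q where abc: "a = v par_a" "b = v par_b" "c = v par_c" "g = v par_g"
    "q = v par_q"
  show ?thesis
    by (rule SE6_has_morphism[where d = 2 and m = 0 and s = 2 and
          p\<^sub>0 = "[:2 * a^2 + 4 * a * b + 6 * a * c + 3 * a * g + 3 * a * q + 2 * b^2 + 6 * b * c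
              + 3 * b * g + 3 * b * q + 4 * c^2 + 4 * c * g + 4 * c * q + g^2 + 2 * g * q + q^2
              + 7 * a + 7 * b + 10 * c + 5 * g + 5 * q + 6,
              - 3 * a - 3 * b - 4 * c - 2 * g - 2 * q - 5,
              1:]" and
          p\<^sub>1 = "[:- 4 * a^2 - 8 * a * b - 10 * a * c - 6 * a * g - 3 * a * q - 4 * b^2 - 10 * b * c
              - 6 * b * g - 2 * b * q - 6 * c^2 - 7 * c * g - 3 * c * q - 2 * g^2 - 2 * g * q
              - 8 * a - 8 * b - 10 * c - 6 * g - 2 * q - 4,
              6 * a + 5 * b + 7 * c + 4 * g + 2 * q + 6,
              - 2:]" and
          p\<^sub>2 = "[:2 * a^2 + 4 * a * b + 4 * a * c + 3 * a * g + 2 * b^2 + 4 * b * c + 3 * b * g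
              + 2 * c^2 + 3 * c * g + g^2 + a + 2 * b + c + g,
              - 3 * a - 2 * b - 3 * c - 2 * g - 1,
              1:]" and
          p\<^sub>3 = 0 and
          p\<^sub>4 = 0 and
          q\<^sub>0 = "[:2 * a^2 + 4 * a * b + 6 * a * c + 3 * a * g + 3 * a * q + 2 * b^2 + 6 * b * c
              + 3 * b * g + 3 * b * q + 4 * c^2 + 4 * c * g + 4 * c * q + g^2 + 2 * g * q + q^2
              + 3 * a + 3 * b + 4 * c + 2 * g + 2 * q + 1,
              - 3 * a - 3 * b - 4 * c - 2 * g - 2 * q - 2,
              1:]" and
          q\<^sub>1 = "[:- 4 * a^2 - 8 * a * b - 10 * a * c - 6 * a * g - 3 * a * q - 4 * b^2 - 10 * b * c
              - 6 * b * g - 2 * b * q - 6 * c^2 - 7 * c * g - 3 * c * q - 2 * g^2 - 2 * g * q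
              + 5 * a + 4 * b + 7 * c + 3 * g + 4 * q + 2,
              6 * a + 5 * b + 7 * c + 4 * g + 2 * q - 3,
              - 2:]" and
          q\<^sub>2 = "[:2 * a^2 + 4 * a * b + 4 * a * c + 3 * a * g + 2 * b^2 + 4 * b * c + 3 * b * g
              + 2 * c^2 + 3 * c * g + g^2 - 8 * a - 4 * b - 8 * c - 5 * g + 6,
              - 3 * a - 2 * b - 3 * c - 2 * g + 5,
              1:]" and
          q\<^sub>3 = 0 and
          q\<^sub>4 = 0 and
          a\<^sub>0 = "SE6_coeff0 a b c g q" and a0' = "SE6_coeff0 a (b - 1) c g (q + 2)" and
          a\<^sub>1 = "SE6_coeff1 a b c g q" and a1' = "SE6_coeff1 a (b - 1) c g (q + 2)" and
          a\<^sub>2 = "SE6_coeff2 a b c g q" and a2' = "SE6_coeff2 a (b - 1) c g (q + 2)" and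
          a\<^sub>3 = "SE6_coeff3 a b c g q" and a3' = "SE6_coeff3 a (b - 1) c g (q + 2)"],
        simp add: eval_nat_numeral,
        (simp_all add: abc shift_param_def SE6_coeffs_def Let_def res)[14])
      (unfold SE6_coeff0_def SE6_coeff1_def SE6_coeff2_def SE6_coeff3_def
         poly_mult poly_minus poly_pCons poly_0, algebra+)
qed

text \<open>The shifts c + 1 and r - 2 cancel in each of e_7, e_8, e_9, which is why
  \<open>p\<^sub>0\<close> and \<open>q\<^sub>0\<close> coincide.\<close>

lemma SE6_morphism_c_plus:
  assumes res: "resonance v \<noteq> 0"
  shows "has_morphism (SE6 v)
    (SE6 (shift_param par_r (- 2) (shift_param par_c 1 v)))"
proof -
  define a b c g q where abc: "a = v par_a" "b = v par_b" "c = v par_c" "g = v par_g"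
    "q = v par_q"
  show ?thesis
    by (rule SE6_has_morphism[where d = 2 and m = 0 and s = 2 and
          p\<^sub>0 = "[:2 * a^2 + 4 * a * b + 10 * a * c + 3 * a * g + 3 * a * q + 2 * b^2 + 10 * b * c
              + 3 * b * g + 3 * b * q + 10 * c^2 + 7 * c * g + 6 * c * q + g^2 + 2 * g * q + q^2
              + 11 * a + 11 * b + 24 * c + 8 * g + 7 * q + 14,
              - 3 * a - 3 * b - 6 * c - 2 * g - 2 * q - 7,
              1:]" and
          p\<^sub>1 = "[:- 4 * a^2 - 4 * a * b - 14 * a * c - 4 * a * g - 3 * a * q - 6 * b * c - 2 * b * g
              - 10 * c^2 - 7 * c * g - 3 * c * q - g^2 - g * q - 12 * a - 4 * b - 18 * c - 6 * g
              - 2 * q - 8,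
              6 * a + 3 * b + 9 * c + 3 * g + 2 * q + 8,
              - 2:]" and
          p\<^sub>2 = "[:2 * a^2 + 4 * a * c + a * g + 2 * c^2 + c * g + a + c, - 3 * a - 3 * c - g - 1, 1:]" and
          p\<^sub>3 = 0 and
          p\<^sub>4 = 0 and
          q\<^sub>0 = "[:2 * a^2 + 4 * a * b + 10 * a * c + 3 * a * g + 3 * a * q + 2 * b^2 + 10 * b * c
              + 3 * b * g + 3 * b * q + 10 * c^2 + 7 * c * g + 6 * c * q + g^2 + 2 * g * q + q^2
              + 11 * a + 11 * b + 24 * c + 8 * g + 7 * q + 14,
              - 3 * a - 3 * b - 6 * c - 2 * g - 2 * q - 7,
              1:]" and
          q\<^sub>1 = "[:- 4 * a^2 - 4 * a * b - 14 * a * c - 4 * a * g - 3 * a * q - 6 * b * c - 2 * b * g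
              - 10 * c^2 - 7 * c * g - 3 * c * q - g^2 - g * q - 7 * a - 9 * c - 3 * g + q + 1,
              6 * a + 3 * b + 9 * c + 3 * g + 2 * q + 5,
              - 2:]" and
          q\<^sub>2 = "[:2 * a^2 + 4 * a * c + a * g + 2 * c^2 + c * g - 4 * a - 4 * c - 2 * g,
              - 3 * a - 3 * c - g + 2,
              1:]" and
          q\<^sub>3 = 0 and
          q\<^sub>4 = 0 and
          a\<^sub>0 = "SE6_coeff0 a b c g q" and a0' = "SE6_coeff0 a b (c + 1) g q" and
          a\<^sub>1 = "SE6_coeff1 a b c g q" and a1' = "SE6_coeff1 a b (c + 1) g q" and
          a\<^sub>2 = "SE6_coeff2 a b c g q" and a2' = "SE6_coeff2 a b (c + 1) g q" and
          a\<^sub>3 = "SE6_coeff3 a b c g q" and a3' = "SE6_coeff3 a b (c + 1) g q"],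
        simp add: eval_nat_numeral,
        (simp_all add: abc shift_param_def SE6_coeffs_def Let_def res)[14])
      (unfold SE6_coeff0_def SE6_coeff1_def SE6_coeff2_def SE6_coeff3_def
         poly_mult poly_minus poly_pCons poly_0, algebra+)
qed

text \<open>Lowering c by 1 and r by 2 raises e_7, e_8, e_9 by 4 in all; p + 2 and q + 2 compensate
  this.\<close>

lemma SE6_morphism_c_minus:
  assumes res: "resonance v \<noteq> 0"
  shows "has_morphism (SE6 v)
    (SE6 (shift_param par_r (- 2) (shift_param par_q 2 (shift_param par_p 2 (shift_param par_c (- 1) v)))))"
proof -
  define a b c g q where abc: "a = v par_a" "b = v par_b" "c = v par_c" "g = v par_g"
    "q = v par_q"
  show ?thesis
    by (rule SE6_has_morphism[where d = 2 and m = 2 and s = 0 and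
          p\<^sub>0 = "[:2 * a * c + a * q + 2 * b * c + b * q + 2 * c^2 + c * g + 2 * c * q + q^2 + a + b
              + 4 * c + 3 * q + 2,
              - a - b - 2 * c - 2 * q - 3,
              1:]" and
          p\<^sub>1 = "[:- 2 * a * c - a * q - 2 * b * c - 2 * c^2 - c * g - c * q - 2 * c,
              2 * a + b + 3 * c + 2 * q + 2,
              - 2:]" and
          p\<^sub>2 = "[:- a - c, - a - c + 1, 1:]" and
          p\<^sub>3 = 0 and
          p\<^sub>4 = 0 and
          q\<^sub>0 = "[:2 * a * c + a * q + 2 * b * c + b * q + 2 * c^2 + c * g + 2 * c * q + q^2 + a + b
              + 4 * c + 3 * q + 2,
              - a - b - 2 * c - 2 * q - 3,
              1:]" and
          q\<^sub>1 = "[:- 2 * a * c - a * q - 2 * b * c - 2 * c^2 - c * g - c * q + a + 2 * b + c + 3 * q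
              + 3,
              2 * a + b + 3 * c + 2 * q - 1,
              - 2:]" and
          q\<^sub>2 = "[:- 2 * a - 2 * c + 4, - a - c + 4, 1:]" and
          q\<^sub>3 = 0 and
          q\<^sub>4 = 0 and
          a\<^sub>0 = "SE6_coeff0 a b c g q" and a0' = "SE6_coeff0 a b (c - 1) g (q + 2)" and
          a\<^sub>1 = "SE6_coeff1 a b c g q" and a1' = "SE6_coeff1 a b (c - 1) g (q + 2)" and
          a\<^sub>2 = "SE6_coeff2 a b c g q" and a2' = "SE6_coeff2 a b (c - 1) g (q + 2)" and
          a\<^sub>3 = "SE6_coeff3 a b c g q" and a3' = "SE6_coeff3 a b (c - 1) g (q + 2)"],
        simp add: eval_nat_numeral,
        (simp_all add: abc shift_param_def SE6_coeffs_def Let_def res)[14])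
      (unfold SE6_coeff0_def SE6_coeff1_def SE6_coeff2_def SE6_coeff3_def
         poly_mult poly_minus poly_pCons poly_0, algebra+)
qed

lemma SE6_morphism_g_plus:
  assumes res: "resonance v \<noteq> 0"
  shows "has_morphism (SE6 v)
    (SE6 (shift_param par_r (- 2) (shift_param par_g 2 v)))"
proof -
  define a b c g q where abc: "a = v par_a" "b = v par_b" "c = v par_c" "g = v par_g"
    "q = v par_q"
  \<comment> \<open>This is the coefficient of w^2 in \<open>p\<^sub>2\<close>; scaling it to 1
    would bring in denominators.\<close>
  have top: "2 * a + 2 * b + 2 * c + 3 * g + 6 \<noteq> 0"
    using res by (simp add: resonance_def Let_def abc)
  show ?thesis
    by (rule SE6_has_morphism[where d = 2 and m = 0 and s = 2 and
          p\<^sub>0 = "[:8 * a^2 * c + 4 * a^2 * q + 16 * a * b * c + 8 * a * b * q + 16 * a * c^2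
              + 16 * a * c * g + 12 * a * c * q + 8 * a * g * q + 2 * a * q^2 + 8 * b^2 * c
              + 4 * b^2 * q + 16 * b * c^2 + 16 * b * c * g + 12 * b * c * q + 8 * b * g * q
              + 2 * b * q^2 + 8 * c^3 + 20 * c^2 * g + 8 * c^2 * q + 8 * c * g^2
              + 16 * c * g * q + 2 * c * q^2 + 4 * g^2 * q + 3 * g * q^2 + 4 * a^2 + 8 * a * b
              + 44 * a * c + 8 * a * g + 20 * a * q + 4 * b^2 + 44 * b * c + 8 * b * g
              + 20 * b * q + 44 * c^2 + 46 * c * g + 34 * c * q + 4 * g^2 + 21 * g * q + 6 * q^2
              + 18 * a + 18 * b + 60 * c + 18 * g + 26 * q + 20,
              - 4 * a^2 - 8 * a * b - 12 * a * c - 8 * a * g - 4 * a * q - 4 * b^2 - 12 * b * c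
              - 8 * b * g - 4 * b * q - 8 * c^2 - 16 * c * g - 4 * c * q - 4 * g^2 - 6 * g * q
              - 20 * a - 20 * b - 34 * c - 21 * g - 12 * q - 26,
              2 * a + 2 * b + 2 * c + 3 * g + 6:]" and
          p\<^sub>1 = "[:- 8 * a^2 * c - 4 * a^2 * q - 16 * a * b * c - 4 * a * b * q - 16 * a * c^2
              - 20 * a * c * g - 8 * a * c * q - 8 * a * g * q - 8 * b^2 * c - 16 * b * c^2
              - 12 * b * c * g - 4 * b * c * q - 8 * c^3 - 20 * c^2 * g - 4 * c^2 * q
              - 8 * c * g^2 - 8 * c * g * q - 2 * g^2 * q - 36 * a * c - 14 * a * q - 28 * b * c
              - 36 * c^2 - 30 * c * g - 14 * c * q - 6 * g * q - 28 * c - 4 * q,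
              8 * a^2 + 12 * a * b + 20 * a * c + 16 * a * g + 4 * a * q + 4 * b^2 + 16 * b * c
              + 8 * b * g + 4 * b * q + 12 * c^2 + 24 * c * g + 4 * c * q + 6 * g^2 + 6 * g * q
              + 32 * a + 18 * b + 46 * c + 24 * g + 12 * q + 24,
              - 4 * a - 4 * b - 4 * c - 6 * g - 12:]" and
          p\<^sub>2 = "[:- 4 * a * b * g - 2 * a * g^2 - 4 * b * c * g - 2 * b * g^2 - 2 * c * g^2 - g^3
              - 4 * a^2 - 8 * a * b - 8 * a * c - 14 * a * g - 8 * b * c - 6 * b * g - 4 * c^2
              - 14 * c * g - 7 * g^2 - 18 * a - 4 * b - 18 * c - 14 * g - 8,
              - 4 * a^2 - 4 * a * b - 8 * a * c - 8 * a * g - 4 * b * c - 4 * c^2 - 8 * c * g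
              - 2 * g^2 - 12 * a + 2 * b - 12 * c - 3 * g + 2,
              2 * a + 2 * b + 2 * c + 3 * g + 6:]" and
          p\<^sub>3 = 0 and
          p\<^sub>4 = 0 and
          q\<^sub>0 = "[:8 * a^2 * c + 4 * a^2 * q + 16 * a * b * c + 8 * a * b * q + 16 * a * c^2
              + 16 * a * c * g + 12 * a * c * q + 8 * a * g * q + 2 * a * q^2 + 8 * b^2 * c
              + 4 * b^2 * q + 16 * b * c^2 + 16 * b * c * g + 12 * b * c * q + 8 * b * g * q
              + 2 * b * q^2 + 8 * c^3 + 20 * c^2 * g + 8 * c^2 * q + 8 * c * g^2
              + 16 * c * g * q + 2 * c * q^2 + 4 * g^2 * q + 3 * g * q^2 - 4 * a^2 - 8 * a * b
              + 28 * a * c - 8 * a * g + 16 * a * q - 4 * b^2 + 28 * b * c - 8 * b * g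
              + 16 * b * q + 36 * c^2 + 26 * c * g + 30 * c * q - 4 * g^2 + 15 * g * q + 6 * q^2
              - 18 * a - 18 * b + 20 * c - 18 * g + 14 * q - 20,
              - 4 * a^2 - 8 * a * b - 12 * a * c - 8 * a * g - 4 * a * q - 4 * b^2 - 12 * b * c
              - 8 * b * g - 4 * b * q - 8 * c^2 - 16 * c * g - 4 * c * q - 4 * g^2 - 6 * g * q
              - 16 * a - 16 * b - 30 * c - 15 * g - 12 * q - 14,
              2 * a + 2 * b + 2 * c + 3 * g + 6:]" and
          q\<^sub>1 = "[:- 8 * a^2 * c - 4 * a^2 * q - 16 * a * b * c - 4 * a * b * q - 16 * a * c^2
              - 20 * a * c * g - 8 * a * c * q - 8 * a * g * q - 8 * b^2 * c - 16 * b * c^2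
              - 12 * b * c * g - 4 * b * c * q - 8 * c^3 - 20 * c^2 * g - 4 * c^2 * q
              - 8 * c * g^2 - 8 * c * g * q - 2 * g^2 * q + 20 * a^2 + 28 * a * b + 4 * a * c
              + 36 * a * g - 6 * a * q + 8 * b^2 + 20 * b * g + 8 * b * q - 16 * c^2
              + 14 * c * g - 6 * c * q + 14 * g^2 + 6 * g * q + 70 * a + 36 * b + 50 * c
              + 48 * g + 20 * q + 40,
              8 * a^2 + 12 * a * b + 20 * a * c + 16 * a * g + 4 * a * q + 4 * b^2 + 16 * b * c
              + 8 * b * g + 4 * b * q + 12 * c^2 + 24 * c * g + 4 * c * q + 6 * g^2 + 6 * g * q
              + 20 * a + 6 * b + 34 * c + 6 * g + 12 * q - 12,
              - 4 * a - 4 * b - 4 * c - 6 * g - 12:]" and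
          q\<^sub>2 = "[:- 4 * a * b * g - 2 * a * g^2 - 4 * b * c * g - 2 * b * g^2 - 2 * c * g^2 - g^3
              - 16 * a^2 - 20 * a * b - 32 * a * c - 38 * a * g - 20 * b * c - 10 * b * g
              - 16 * c^2 - 38 * c * g - 15 * g^2 - 52 * a - 52 * c - 26 * g,
              - 4 * a^2 - 4 * a * b - 8 * a * c - 8 * a * g - 4 * b * c - 4 * c^2 - 8 * c * g
              - 2 * g^2 - 4 * a + 10 * b - 4 * c + 9 * g + 26,
              2 * a + 2 * b + 2 * c + 3 * g + 6:]" and
          q\<^sub>3 = 0 and
          q\<^sub>4 = 0 and
          a\<^sub>0 = "SE6_coeff0 a b c g q" and a0' = "SE6_coeff0 a b c (g + 2) q" and
          a\<^sub>1 = "SE6_coeff1 a b c g q" and a1' = "SE6_coeff1 a b c (g + 2) q" and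
          a\<^sub>2 = "SE6_coeff2 a b c g q" and a2' = "SE6_coeff2 a b c (g + 2) q" and
          a\<^sub>3 = "SE6_coeff3 a b c g q" and a3' = "SE6_coeff3 a b c (g + 2) q"],
        use top in \<open>simp add: eval_nat_numeral\<close>,
        (simp_all add: abc shift_param_def SE6_coeffs_def Let_def res)[14])
      (unfold SE6_coeff0_def SE6_coeff1_def SE6_coeff2_def SE6_coeff3_def
         poly_mult poly_minus poly_pCons poly_0, algebra+)
qed

text \<open>With p + 2, q + 2 and r - 4 the exponent e_7 is fixed, and e_3 and e_6 fall by d = 4.
  The operator has order 6, so here alone the comparison of top coefficients decides that it does
  not vanish modulo \<open>SE6 v\<close>.\<close>

lemma SE6_morphism_g_minus:
  assumes res: "resonance v \<noteq> 0"
  shows "has_morphism (SE6 v)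
    (SE6 (shift_param par_r (- 4) (shift_param par_q 2 (shift_param par_p 2 (shift_param par_g (- 2) v)))))"
proof -
  define a b c g q where abc: "a = v par_a" "b = v par_b" "c = v par_c" "g = v par_g"
    "q = v par_q"
  have "(2 * b + g) * (a + c + g) \<noteq> 0"
    using res by (simp add: resonance_def Let_def abc)
  \<comment> \<open>This is the coefficient of w^2 in \<open>p\<^sub>4\<close>, in expanded
    form.\<close>
  then have top: "2 * a * b + a * g + 2 * b * c + 2 * b * g + c * g + g^2 \<noteq> 0"
    by (simp add: algebra_simps power2_eq_square)
  show ?thesis
    by (rule SE6_has_morphism[where d = 4 and m = 2 and s = 2 and
          p\<^sub>0 = "[:4 * a^3 * c + 2 * a^3 * g + 12 * a^2 * b * c + 6 * a^2 * b * g + 12 * a^2 * c^2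
              + 16 * a^2 * c * g + 6 * a^2 * c * q + 5 * a^2 * g^2 + 3 * a^2 * g * q
              + 12 * a * b^2 * c + 6 * a * b^2 * g + 24 * a * b * c^2 + 32 * a * b * c * g
              + 12 * a * b * c * q + 10 * a * b * g^2 + 6 * a * b * g * q + 8 * a * c^3
              + 24 * a * c^2 * g + 8 * a * c^2 * q + 18 * a * c * g^2 + 14 * a * c * g * q
              + 2 * a * c * q^2 + 4 * a * g^3 + 5 * a * g^2 * q + a * g * q^2 + 4 * b^3 * c
              + 2 * b^3 * g + 12 * b^2 * c^2 + 16 * b^2 * c * g + 6 * b^2 * c * q
              + 5 * b^2 * g^2 + 3 * b^2 * g * q + 8 * b * c^3 + 24 * b * c^2 * g
              + 8 * b * c^2 * q + 18 * b * c * g^2 + 14 * b * c * g * q + 2 * b * c * q^2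
              + 4 * b * g^3 + 5 * b * g^2 * q + b * g * q^2 + 8 * c^3 * g + 12 * c^2 * g^2
              + 8 * c^2 * g * q + 6 * c * g^3 + 8 * c * g^2 * q + 2 * c * g * q^2 + g^4
              + 2 * g^3 * q + g^2 * q^2 + 14 * a^2 * c + 7 * a^2 * g + 28 * a * b * c
              + 14 * a * b * g + 20 * a * c^2 + 34 * a * c * g + 10 * a * c * q + 12 * a * g^2
              + 5 * a * g * q + 14 * b^2 * c + 7 * b^2 * g + 20 * b * c^2 + 34 * b * c * g
              + 10 * b * c * q + 12 * b * g^2 + 5 * b * g * q + 20 * c^2 * g + 20 * c * g^2
              + 10 * c * g * q + 5 * g^3 + 5 * g^2 * q + 12 * a * c + 6 * a * g + 12 * b * c
              + 6 * b * g + 12 * c * g + 6 * g^2,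
              - 6 * a^2 * c - 3 * a^2 * g - 12 * a * b * c - 6 * a * b * g - 8 * a * c^2
              - 14 * a * c * g - 4 * a * c * q - 5 * a * g^2 - 2 * a * g * q - 6 * b^2 * c
              - 3 * b^2 * g - 8 * b * c^2 - 14 * b * c * g - 4 * b * c * q - 5 * b * g^2
              - 2 * b * g * q - 8 * c^2 * g - 8 * c * g^2 - 4 * c * g * q - 2 * g^3
              - 2 * g^2 * q - 10 * a * c - 5 * a * g - 10 * b * c - 5 * b * g - 10 * c * g
              - 5 * g^2,
              2 * a * c + a * g + 2 * b * c + b * g + 2 * c * g + g^2:]" and
          p\<^sub>1 = "[:- 8 * a^3 * c - 4 * a^3 * g - 24 * a^2 * b * c - 12 * a^2 * b * g - 20 * a^2 * c^2
              - 30 * a^2 * c * g - 6 * a^2 * c * q - 10 * a^2 * g^2 - 3 * a^2 * g * q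
              - 24 * a * b^2 * c - 12 * a * b^2 * g - 48 * a * b * c^2 - 64 * a * b * c * g
              - 18 * a * b * c * q - 20 * a * b * g^2 - 9 * a * b * g * q - 12 * a * c^3
              - 44 * a * c^2 * g - 6 * a * c^2 * q - 35 * a * c * g^2 - 17 * a * c * g * q
              - 8 * a * g^3 - 7 * a * g^2 * q - 8 * b^3 * c - 4 * b^3 * g - 28 * b^2 * c^2
              - 34 * b^2 * c * g - 12 * b^2 * c * q - 10 * b^2 * g^2 - 6 * b^2 * g * q
              - 20 * b * c^3 - 52 * b * c^2 * g - 18 * b * c^2 * q - 37 * b * c * g^2
              - 25 * b * c * g * q - 4 * b * c * q^2 - 8 * b * g^3 - 8 * b * g^2 * q
              - 2 * b * g * q^2 - 16 * c^3 * g - 24 * c^2 * g^2 - 12 * c^2 * g * q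
              - 12 * c * g^3 - 12 * c * g^2 * q - 2 * c * g * q^2 - 2 * g^4 - 3 * g^3 * q
              - g^2 * q^2 - 16 * a^2 * c - 8 * a^2 * g - 32 * a * b * c - 16 * a * b * g
              - 20 * a * c^2 - 38 * a * c * g - 4 * a * c * q - 14 * a * g^2 - 2 * a * g * q
              - 16 * b^2 * c - 8 * b^2 * g - 28 * b * c^2 - 42 * b * c * g - 12 * b * c * q
              - 14 * b * g^2 - 6 * b * g * q - 24 * c^2 * g - 24 * c * g^2 - 8 * c * g * q
              - 6 * g^3 - 4 * g^2 * q - 8 * a * c - 4 * a * g - 8 * b * c - 4 * b * g
              - 8 * c * g - 4 * g^2,
              12 * a^2 * c + 6 * a^2 * g + 30 * a * b * c + 15 * a * b * g + 14 * a * c^2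
              + 31 * a * c * g + 4 * a * c * q + 12 * a * g^2 + 2 * a * g * q + 18 * b^2 * c
              + 9 * b^2 * g + 26 * b * c^2 + 39 * b * c * g + 12 * b * c * q + 13 * b * g^2
              + 6 * b * g * q + 20 * c^2 * g + 20 * c * g^2 + 8 * c * g * q + 5 * g^3
              + 4 * g^2 * q + 12 * a * c + 6 * a * g + 20 * b * c + 10 * b * g + 16 * c * g
              + 8 * g^2,
              - 4 * a * c - 2 * a * g - 8 * b * c - 4 * b * g - 6 * c * g - 3 * g^2:]" and
          p\<^sub>2 = "[:4 * a^3 * c + 2 * a^3 * g + 16 * a^2 * b * c + 6 * a^2 * b * g + 2 * a^2 * b * q
              + 8 * a^2 * c^2 + 16 * a^2 * c * g + 5 * a^2 * g^2 + a^2 * g * q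
              + 16 * a * b^2 * c + 6 * a * b^2 * g + 2 * a * b^2 * q + 32 * a * b * c^2
              + 40 * a * b * c * g + 14 * a * b * c * q + 10 * a * b * g^2 + 7 * a * b * g * q
              + 2 * a * b * q^2 + 4 * a * c^3 + 24 * a * c^2 * g + 20 * a * c * g^2
              + 7 * a * c * g * q + 4 * a * g^3 + 3 * a * g^2 * q + a * g * q^2 + 4 * b^3 * c
              + 2 * b^3 * g + 20 * b^2 * c^2 + 22 * b^2 * c * g + 6 * b^2 * c * q
              + 5 * b^2 * g^2 + 4 * b^2 * g * q + 16 * b * c^3 + 36 * b * c^2 * g
              + 12 * b * c^2 * q + 23 * b * c * g^2 + 15 * b * c * g * q + 2 * b * c * q^2
              + 4 * b * g^3 + 4 * b * g^2 * q + 2 * b * g * q^2 + 10 * c^3 * g + 15 * c^2 * g^2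
              + 6 * c^2 * g * q + 7 * c * g^3 + 6 * c * g^2 * q + c * g * q^2 + g^4 + g^3 * q
              + g^2 * q^2 - 2 * a^2 * b + 2 * a^2 * c - 2 * a * b^2 - 12 * a * b * c
              - 8 * a * b * g - 2 * a * b * q + 2 * a * c^2 - 4 * a * c * g - 3 * a * g^2
              - a * g * q - 10 * b^2 * c - 6 * b^2 * g - 10 * b * c^2 - 14 * b * c * g
              - 6 * b * c * q - 5 * b * g^2 - 4 * b * g * q - 4 * c^2 * g - 4 * c * g^2
              - 3 * c * g * q - g^3 - 2 * g^2 * q - 8 * b * c - 4 * b * g - 4 * c * g - 2 * g^2,
              - 2 * a^2 * b - 6 * a^2 * c - 4 * a^2 * g - 2 * a * b^2 - 32 * a * b * c
              - 16 * a * b * g - 4 * a * b * q - 6 * a * c^2 - 24 * a * c * g - 10 * a * g^2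
              - 2 * a * g * q - 18 * b^2 * c - 10 * b^2 * g - 30 * b * c^2 - 40 * b * c * g
              - 12 * b * c * q - 12 * b * g^2 - 8 * b * g * q - 18 * c^2 * g - 18 * c * g^2
              - 6 * c * g * q - 4 * g^3 - 4 * g^2 * q + 2 * a * b - 2 * a * c + b * g - c * g,
              2 * a * b + 2 * a * c + 2 * a * g + 12 * b * c + 7 * b * g + 7 * c * g + 4 * g^2:]" and
          p\<^sub>3 = "[:- 4 * a^2 * b * c - 2 * a^2 * b * q - 2 * a^2 * c * g - a^2 * g * q
              - 4 * a * b^2 * c - 8 * a * b * c^2 - 8 * a * b * c * g - 4 * a * b * c * q
              - 2 * a * b * g * q - 4 * a * c^2 * g - 3 * a * c * g^2 - 2 * a * c * g * q
              - a * g^2 * q - 4 * b^2 * c^2 - 4 * b^2 * c * g - 4 * b * c^3 - 8 * b * c^2 * g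
              - 2 * b * c^2 * q - 4 * b * c * g^2 - 2 * b * c * g * q - 2 * c^3 * g
              - 3 * c^2 * g^2 - c^2 * g * q - c * g^3 - c * g^2 * q + 8 * a^2 * b + 4 * a^2 * g
              + 4 * a * b^2 + 32 * a * b * c + 18 * a * b * g + 8 * a * b * q + 16 * a * c * g
              + 8 * a * g^2 + 4 * a * g * q + 12 * b^2 * c + 8 * b^2 * g + 24 * b * c^2
              + 30 * b * c * g + 8 * b * c * q + 8 * b * g^2 + 8 * b * g * q + 12 * c^2 * g
              + 12 * c * g^2 + 4 * c * g * q + 2 * g^3 + 4 * g^2 * q - 8 * a * b - 4 * a * g
              - 8 * b * c - 8 * b * g - 4 * c * g - 4 * g^2,
              4 * a^2 * b + 2 * a^2 * g + 2 * a * b^2 + 18 * a * b * c + 9 * a * b * g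
              + 4 * a * b * q + 9 * a * c * g + 4 * a * g^2 + 2 * a * g * q + 6 * b^2 * c
              + 4 * b^2 * g + 14 * b * c^2 + 17 * b * c * g + 4 * b * c * q + 4 * b * g^2
              + 4 * b * g * q + 7 * c^2 * g + 7 * c * g^2 + 2 * c * g * q + g^3 + 2 * g^2 * q
              - 12 * a * b - 6 * a * g - 20 * b * c - 16 * b * g - 10 * c * g - 8 * g^2,
              - 4 * a * b - 2 * a * g - 8 * b * c - 6 * b * g - 4 * c * g - 3 * g^2:]" and
          p\<^sub>4 = "[:- 6 * a^2 * b - 3 * a^2 * g - 12 * a * b * c - 6 * a * b * g - 6 * a * c * g
              - 3 * a * g^2 - 6 * b * c^2 - 6 * b * c * g - 3 * c^2 * g - 3 * c * g^2
              + 12 * a * b + 6 * a * g + 12 * b * c + 12 * b * g + 6 * c * g + 6 * g^2,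
              - 2 * a^2 * b - a^2 * g - 4 * a * b * c - 2 * a * b * g - 2 * a * c * g - a * g^2
              - 2 * b * c^2 - 2 * b * c * g - c^2 * g - c * g^2 + 10 * a * b + 5 * a * g
              + 10 * b * c + 10 * b * g + 5 * c * g + 5 * g^2,
              2 * a * b + a * g + 2 * b * c + 2 * b * g + c * g + g^2:]" and
          q\<^sub>0 = "[:4 * a^3 * c + 2 * a^3 * g + 12 * a^2 * b * c + 6 * a^2 * b * g + 12 * a^2 * c^2
              + 16 * a^2 * c * g + 6 * a^2 * c * q + 5 * a^2 * g^2 + 3 * a^2 * g * q
              + 12 * a * b^2 * c + 6 * a * b^2 * g + 24 * a * b * c^2 + 32 * a * b * c * g
              + 12 * a * b * c * q + 10 * a * b * g^2 + 6 * a * b * g * q + 8 * a * c^3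
              + 24 * a * c^2 * g + 8 * a * c^2 * q + 18 * a * c * g^2 + 14 * a * c * g * q
              + 2 * a * c * q^2 + 4 * a * g^3 + 5 * a * g^2 * q + a * g * q^2 + 4 * b^3 * c
              + 2 * b^3 * g + 12 * b^2 * c^2 + 16 * b^2 * c * g + 6 * b^2 * c * q
              + 5 * b^2 * g^2 + 3 * b^2 * g * q + 8 * b * c^3 + 24 * b * c^2 * g
              + 8 * b * c^2 * q + 18 * b * c * g^2 + 14 * b * c * g * q + 2 * b * c * q^2
              + 4 * b * g^3 + 5 * b * g^2 * q + b * g * q^2 + 8 * c^3 * g + 12 * c^2 * g^2
              + 8 * c^2 * g * q + 6 * c * g^3 + 8 * c * g^2 * q + 2 * c * g * q^2 + g^4
              + 2 * g^3 * q + g^2 * q^2 + 2 * a^2 * c + a^2 * g + 4 * a * b * c + 2 * a * b * g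
              + 4 * a * c^2 + 6 * a * c * g + 2 * a * c * q + 2 * a * g^2 + a * g * q
              + 2 * b^2 * c + b^2 * g + 4 * b * c^2 + 6 * b * c * g + 2 * b * c * q
              + 2 * b * g^2 + b * g * q + 4 * c^2 * g + 4 * c * g^2 + 2 * c * g * q + g^3
              + g^2 * q,
              - 6 * a^2 * c - 3 * a^2 * g - 12 * a * b * c - 6 * a * b * g - 8 * a * c^2
              - 14 * a * c * g - 4 * a * c * q - 5 * a * g^2 - 2 * a * g * q - 6 * b^2 * c
              - 3 * b^2 * g - 8 * b * c^2 - 14 * b * c * g - 4 * b * c * q - 5 * b * g^2
              - 2 * b * g * q - 8 * c^2 * g - 8 * c * g^2 - 4 * c * g * q - 2 * g^3
              - 2 * g^2 * q - 2 * a * c - a * g - 2 * b * c - b * g - 2 * c * g - g^2,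
              2 * a * c + a * g + 2 * b * c + b * g + 2 * c * g + g^2:]" and
          q\<^sub>1 = "[:- 8 * a^3 * c - 4 * a^3 * g - 24 * a^2 * b * c - 12 * a^2 * b * g - 20 * a^2 * c^2
              - 30 * a^2 * c * g - 6 * a^2 * c * q - 10 * a^2 * g^2 - 3 * a^2 * g * q
              - 24 * a * b^2 * c - 12 * a * b^2 * g - 48 * a * b * c^2 - 64 * a * b * c * g
              - 18 * a * b * c * q - 20 * a * b * g^2 - 9 * a * b * g * q - 12 * a * c^3
              - 44 * a * c^2 * g - 6 * a * c^2 * q - 35 * a * c * g^2 - 17 * a * c * g * q
              - 8 * a * g^3 - 7 * a * g^2 * q - 8 * b^3 * c - 4 * b^3 * g - 28 * b^2 * c^2
              - 34 * b^2 * c * g - 12 * b^2 * c * q - 10 * b^2 * g^2 - 6 * b^2 * g * q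
              - 20 * b * c^3 - 52 * b * c^2 * g - 18 * b * c^2 * q - 37 * b * c * g^2
              - 25 * b * c * g * q - 4 * b * c * q^2 - 8 * b * g^3 - 8 * b * g^2 * q
              - 2 * b * g * q^2 - 16 * c^3 * g - 24 * c^2 * g^2 - 12 * c^2 * g * q
              - 12 * c * g^3 - 12 * c * g^2 * q - 2 * c * g * q^2 - 2 * g^4 - 3 * g^3 * q
              - g^2 * q^2 + 18 * a^2 * c + 9 * a^2 * g + 34 * a * b * c + 17 * a * b * g
              + 22 * a * c^2 + 39 * a * c * g + 12 * a * c * q + 14 * a * g^2 + 6 * a * g * q
              + 16 * b^2 * c + 8 * b^2 * g + 18 * b * c^2 + 35 * b * c * g + 8 * b * c * q
              + 13 * b * g^2 + 4 * b * g * q + 20 * c^2 * g + 20 * c * g^2 + 10 * c * g * q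
              + 5 * g^3 + 5 * g^2 * q,
              12 * a^2 * c + 6 * a^2 * g + 30 * a * b * c + 15 * a * b * g + 14 * a * c^2
              + 31 * a * c * g + 4 * a * c * q + 12 * a * g^2 + 2 * a * g * q + 18 * b^2 * c
              + 9 * b^2 * g + 26 * b * c^2 + 39 * b * c * g + 12 * b * c * q + 13 * b * g^2
              + 6 * b * g * q + 20 * c^2 * g + 20 * c * g^2 + 8 * c * g * q + 5 * g^3
              + 4 * g^2 * q - 12 * a * c - 6 * a * g - 8 * b * c - 4 * b * g - 10 * c * g
              - 5 * g^2,
              - 4 * a * c - 2 * a * g - 8 * b * c - 4 * b * g - 6 * c * g - 3 * g^2:]" and
          q\<^sub>2 = "[:4 * a^3 * c + 2 * a^3 * g + 16 * a^2 * b * c + 6 * a^2 * b * g + 2 * a^2 * b * q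
              + 8 * a^2 * c^2 + 16 * a^2 * c * g + 5 * a^2 * g^2 + a^2 * g * q
              + 16 * a * b^2 * c + 6 * a * b^2 * g + 2 * a * b^2 * q + 32 * a * b * c^2
              + 40 * a * b * c * g + 14 * a * b * c * q + 10 * a * b * g^2 + 7 * a * b * g * q
              + 2 * a * b * q^2 + 4 * a * c^3 + 24 * a * c^2 * g + 20 * a * c * g^2
              + 7 * a * c * g * q + 4 * a * g^3 + 3 * a * g^2 * q + a * g * q^2 + 4 * b^3 * c
              + 2 * b^3 * g + 20 * b^2 * c^2 + 22 * b^2 * c * g + 6 * b^2 * c * q
              + 5 * b^2 * g^2 + 4 * b^2 * g * q + 16 * b * c^3 + 36 * b * c^2 * g
              + 12 * b * c^2 * q + 23 * b * c * g^2 + 15 * b * c * g * q + 2 * b * c * q^2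
              + 4 * b * g^3 + 4 * b * g^2 * q + 2 * b * g * q^2 + 10 * c^3 * g + 15 * c^2 * g^2
              + 6 * c^2 * g * q + 7 * c * g^3 + 6 * c * g^2 * q + c * g * q^2 + g^4 + g^3 * q
              + g^2 * q^2 + 2 * a^2 * b - 20 * a^2 * c - 9 * a^2 * g + 2 * a * b^2
              - 58 * a * b * c - 27 * a * b * g + 2 * a * b * q - 20 * a * c^2 - 55 * a * c * g
              - 22 * a * g^2 + a * g * q - 38 * b^2 * c - 18 * b^2 * g - 56 * b * c^2
              - 77 * b * c * g - 22 * b * c * q - 24 * b * g^2 - 10 * b * g * q - 38 * c^2 * g
              - 37 * c * g^2 - 11 * c * g * q - 9 * g^3 - 5 * g^2 * q + 24 * a * c + 12 * a * g
              + 24 * b * c + 12 * b * g + 24 * c * g + 12 * g^2,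
              - 2 * a^2 * b - 6 * a^2 * c - 4 * a^2 * g - 2 * a * b^2 - 32 * a * b * c
              - 16 * a * b * g - 4 * a * b * q - 6 * a * c^2 - 24 * a * c * g - 10 * a * g^2
              - 2 * a * g * q - 18 * b^2 * c - 10 * b^2 * g - 30 * b * c^2 - 40 * b * c * g
              - 12 * b * c * q - 12 * b * g^2 - 8 * b * g * q - 18 * c^2 * g - 18 * c * g^2
              - 6 * c * g * q - 4 * g^3 - 4 * g^2 * q - 2 * a * b + 14 * a * c + 6 * a * g
              + 36 * b * c + 17 * b * g + 25 * c * g + 12 * g^2,
              2 * a * b + 2 * a * c + 2 * a * g + 12 * b * c + 7 * b * g + 7 * c * g + 4 * g^2:]" and
          q\<^sub>3 = "[:- 4 * a^2 * b * c - 2 * a^2 * b * q - 2 * a^2 * c * g - a^2 * g * q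
              - 4 * a * b^2 * c - 8 * a * b * c^2 - 8 * a * b * c * g - 4 * a * b * c * q
              - 2 * a * b * g * q - 4 * a * c^2 * g - 3 * a * c * g^2 - 2 * a * c * g * q
              - a * g^2 * q - 4 * b^2 * c^2 - 4 * b^2 * c * g - 4 * b * c^3 - 8 * b * c^2 * g
              - 2 * b * c^2 * q - 4 * b * c * g^2 - 2 * b * c * g * q - 2 * c^3 * g
              - 3 * c^2 * g^2 - c^2 * g * q - c * g^3 - c * g^2 * q + 6 * a^2 * b + 3 * a^2 * g
              + 4 * a * b^2 + 48 * a * b * c + 22 * a * b * g + 12 * a * b * q + 24 * a * c * g
              + 10 * a * g^2 + 6 * a * g * q + 20 * b^2 * c + 12 * b^2 * g + 42 * b * c^2
              + 50 * b * c * g + 12 * b * c * q + 12 * b * g^2 + 12 * b * g * q + 21 * c^2 * g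
              + 20 * c * g^2 + 6 * c * g * q + 3 * g^3 + 6 * g^2 * q - 48 * b * c - 24 * b * g
              - 24 * c * g - 12 * g^2,
              4 * a^2 * b + 2 * a^2 * g + 2 * a * b^2 + 18 * a * b * c + 9 * a * b * g
              + 4 * a * b * q + 9 * a * c * g + 4 * a * g^2 + 2 * a * g * q + 6 * b^2 * c
              + 4 * b^2 * g + 14 * b * c^2 + 17 * b * c * g + 4 * b * c * q + 4 * b * g^2
              + 4 * b * g * q + 7 * c^2 * g + 7 * c * g^2 + 2 * c * g * q + g^3 + 2 * g^2 * q
              - 12 * a * b - 6 * a * g - 40 * b * c - 26 * b * g - 20 * c * g - 13 * g^2,
              - 4 * a * b - 2 * a * g - 8 * b * c - 6 * b * g - 4 * c * g - 3 * g^2:]" and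
          q\<^sub>4 = "[:- 8 * a^2 * b - 4 * a^2 * g - 16 * a * b * c - 8 * a * b * g - 8 * a * c * g
              - 4 * a * g^2 - 8 * b * c^2 - 8 * b * c * g - 4 * c^2 * g - 4 * c * g^2
              + 24 * a * b + 12 * a * g + 24 * b * c + 24 * b * g + 12 * c * g + 12 * g^2,
              - 2 * a^2 * b - a^2 * g - 4 * a * b * c - 2 * a * b * g - 2 * a * c * g - a * g^2
              - 2 * b * c^2 - 2 * b * c * g - c^2 * g - c * g^2 + 14 * a * b + 7 * a * g
              + 14 * b * c + 14 * b * g + 7 * c * g + 7 * g^2,
              2 * a * b + a * g + 2 * b * c + 2 * b * g + c * g + g^2:]" and
          a\<^sub>0 = "SE6_coeff0 a b c g q" and a0' = "SE6_coeff0 a b c (g - 2) (q + 2)" and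
          a\<^sub>1 = "SE6_coeff1 a b c g q" and a1' = "SE6_coeff1 a b c (g - 2) (q + 2)" and
          a\<^sub>2 = "SE6_coeff2 a b c g q" and a2' = "SE6_coeff2 a b c (g - 2) (q + 2)" and
          a\<^sub>3 = "SE6_coeff3 a b c g q" and a3' = "SE6_coeff3 a b c (g - 2) (q + 2)"],
        use top in \<open>simp add: eval_nat_numeral\<close>,
        (simp_all add: abc shift_param_def SE6_coeffs_def Let_def res)[14])
      (unfold SE6_coeff0_def SE6_coeff1_def SE6_coeff2_def SE6_coeff3_def
         poly_mult poly_minus poly_pCons poly_0, algebra+)
qed

subsection \<open>Removing the auxiliary shifts\<close>

lemma shift_param_0 [simp]: "shift_param i 0 v = v"
  by (simp add: shift_param_def)

lemma shift_param_add [simp]: "shift_param i k (shift_param i l v) = shift_param i (l + k) v"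
  by (simp add: shift_param_def add.assoc)

text \<open>The operators for p and q also lower r; the inverse of the r-step at the target restores
  it. A downward step is an upward step from the shifted parameters read backwards, whence the
  margin 4 = 3 + 1.\<close>

lemma diffop_equiv_unit_shift:
  assumes "nonresonant 4 v" "i \<in> {par_p, par_q, par_r}" "\<epsilon> = 1 \<or> \<epsilon> = - 1"
  shows "diffop_equiv (SE6 v) (SE6 (shift_param i \<epsilon> v))"
proof -
  have up: "diffop_equiv (SE6 v) (SE6 (shift_param i 1 v))" if res: "nonresonant 3 v" for v
  proof -
    have res1: "nonresonant 0 (shift_param i 1 v)"
      using nonresonant_shift[of 3 0 v 1 i] res by simp
    note down = diffop_equiv_r(2)[OF nonresonantD[OF res1], THEN diffop_equiv_sym]
    consider "i = par_r" | "i = par_p" | "i = par_q" using assms(2) by auto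
    then show ?thesis
    proof cases
      case 1
      then show ?thesis using down by simp
    next
      case 2
      then show ?thesis using diffop_equiv_trans[OF diffop_equiv_p[OF res]] down by simp
    next
      case 3
      then show ?thesis using diffop_equiv_trans[OF diffop_equiv_q[OF res]] down by simp
    qed
  qed
  have "nonresonant 3 v" "nonresonant 3 (shift_param i (- 1) v)"
    using assms(1) nonresonant_shift[of 1 3 v "- 1" i] by (simp_all add: nonresonant_mono)
  then show ?thesis
    using up[of v] up[of "shift_param i (- 1) v", THEN diffop_equiv_sym] assms(3) by auto
qed

lemma diffop_equiv_shift:
  assumes "nonresonant (4 + n) v" "i \<in> {par_p, par_q, par_r}" "\<bar>k\<bar> \<le> int n"
  shows "diffop_equiv (SE6 v) (SE6 (shift_param i (of_int k) v))"
  using assms(1,3)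
proof (induction n arbitrary: v k)
  case 0
  then show ?case by (simp add: diffop_equiv_refl)
next
  case (Suc n)
  show ?case
  proof (cases "k = 0")
    case False
    define e :: int where "e = sgn k"
    have e: "\<bar>e\<bar> \<le> int 1" "\<bar>k - e\<bar> \<le> int n" "of_int e = (1 :: complex) \<or> of_int e = (- 1 :: complex)"
      using False Suc.prems(2) by (auto simp: e_def sgn_if)
    have "nonresonant (4 + n) (shift_param i (of_int e) v)"
      using Suc.prems(1) by (intro nonresonant_shift[OF _ e(1)]) simp
    from Suc.IH[OF this e(2)]
    have "diffop_equiv (SE6 (shift_param i (of_int e) v)) (SE6 (shift_param i (of_int k) v))"
      by simp
    moreover have "diffop_equiv (SE6 v) (SE6 (shift_param i (of_int e) v))"
      using Suc.prems(1) by (intro diffop_equiv_unit_shift[OF _ assms(2) e(3)]) (simp add: nonresonant_mono)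
    ultimately show ?thesis by (rule diffop_equiv_trans[rotated])
  qed (simp add: diffop_equiv_refl)
qed

text \<open>The margin 12 consists of 2 for p, 2 for q and 8 for r: up to 4 unit steps, and the 4
  that a unit step requires.\<close>

lemma has_morphism_unshift:
  assumes mor: "has_morphism (SE6 v)
      (SE6 (shift_param par_r (of_int k) (shift_param par_q (of_int n) (shift_param par_p (of_int m) w))))"
    and res: "nonresonant 12 w" and "\<bar>k\<bar> \<le> 4" "\<bar>n\<bar> \<le> 2" "\<bar>m\<bar> \<le> 2"
  shows "has_morphism (SE6 v) (SE6 w)"
proof -
  let ?w1 = "shift_param par_p (of_int m) w"
  let ?w2 = "shift_param par_q (of_int n) ?w1"
  have res1: "nonresonant 10 ?w1"
    using nonresonant_shift[of 2 10 w m par_p] assms by simp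
  have res2: "nonresonant 8 ?w2"
    using nonresonant_shift[of 2 8 ?w1 n par_q] res1 assms by simp
  have "diffop_equiv (SE6 w) (SE6 ?w1)"
    using diffop_equiv_shift[of 2 w par_p m] assms nonresonant_mono[of 12 w 6] by simp
  moreover have "diffop_equiv (SE6 ?w1) (SE6 ?w2)"
    using diffop_equiv_shift[of 2 ?w1 par_q n] assms nonresonant_mono[OF res1, of 6] by simp
  moreover have "diffop_equiv (SE6 ?w2) (SE6 (shift_param par_r (of_int k) ?w2))"
    using diffop_equiv_shift[of 4 ?w2 par_r k] assms res2 by simp
  ultimately have "diffop_equiv (SE6 w) (SE6 (shift_param par_r (of_int k) ?w2))"
    by (blast intro: diffop_equiv_trans)
  then show ?thesis
    using has_morphism_equiv_right[OF mor] diffop_equiv_sym by blast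
qed

section \<open>From morphisms to the generic existence of shift operators\<close>

lemma admits_shift_operator_SE6I:
  assumes "\<And>v. nonresonant 14 v \<Longrightarrow> has_morphism (SE6 v) (SE6 (sh v))"
  shows "admits_shift_operator SE6 sh"
proof -
  have "\<exists>P. is_shift_operator SE6 sh v P" if "nonresonant 14 v" for v
    using assms[OF that] by (intro has_morphism_imp_shift_operator) simp_all
  then show ?thesis
    using generically_nonresonant[of 14] unfolding admits_shift_operator_def generically_def by blast
qed

lemma admits_shift_operator_equiv:
  assumes "i \<in> {par_p, par_q, par_r}" "\<epsilon> = 1 \<or> \<epsilon> = - 1"
  shows "admits_shift_operator SE6 (shift_param i \<epsilon>)"
proof (rule admits_shift_operator_SE6I)
  fix v assume "nonresonant 14 v"
  then have "nonresonant 4 v" by (rule nonresonant_mono) simp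
  from diffop_equiv_unit_shift[OF this assms]
  show "has_morphism (SE6 v) (SE6 (shift_param i \<epsilon> v))"
    by (rule diffop_equiv_imp_has_morphism) simp
qed

text \<open>Shifting the chosen parameter by at most 2 reduces the margin from 14 to the 12 needed
  for undoing the auxiliary shifts.\<close>

lemma admits_shift_operator_morphism:
  fixes k m n l :: int
  assumes "\<And>v. resonance v \<noteq> 0 \<Longrightarrow> has_morphism (SE6 v) (SE6 (shift_param par_r (of_int k)
      (shift_param par_q (of_int n) (shift_param par_p (of_int m) (shift_param i (of_int l) v)))))"
    and "\<bar>k\<bar> \<le> 4" "\<bar>n\<bar> \<le> 2" "\<bar>m\<bar> \<le> 2" "\<bar>l\<bar> \<le> 2"
  shows "admits_shift_operator SE6 (shift_param i (of_int l))"
proof (rule admits_shift_operator_SE6I)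
  fix v assume res: "nonresonant 14 v"
  have "nonresonant 12 (shift_param i (of_int l) v)"
    using nonresonant_shift[of 2 12 v l i] res assms(5) by simp
  with assms(1)[OF nonresonantD[OF res]]
  show "has_morphism (SE6 v) (SE6 (shift_param i (of_int l) v))"
    by (rule has_morphism_unshift) (use assms in simp_all)
qed

theorem theorem5p2:
  fixes \<epsilon> :: complex
  assumes "\<epsilon> = 1 \<or> \<epsilon> = - 1"
  shows "admits_shift_operator SE6 (shift_param par_a \<epsilon>)
       \<and> admits_shift_operator SE6 (shift_param par_b \<epsilon>)
       \<and> admits_shift_operator SE6 (shift_param par_c \<epsilon>)
       \<and> admits_shift_operator SE6 (shift_param par_g (2 * \<epsilon>))
       \<and> admits_shift_operator SE6 (shift_param par_p \<epsilon>)
       \<and> admits_shift_operator SE6 (shift_param par_q \<epsilon>)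
       \<and> admits_shift_operator SE6 (shift_param par_r \<epsilon>)"
proof -
  note mor = admits_shift_operator_morphism
  \<comment> \<open>The first three arguments of \<open>mor\<close> are the auxiliary shifts of r, q
    and p, in this order; zero shifts disappear.\<close>
  have "admits_shift_operator SE6 (shift_param par_a \<epsilon>)"
    using assms mor[of "- 2" 0 0 par_a 1] mor[of "- 2" 0 2 par_a "- 1"]
      SE6_morphism_a_plus SE6_morphism_a_minus by auto
  moreover have "admits_shift_operator SE6 (shift_param par_b \<epsilon>)"
    using assms mor[of "- 2" 0 0 par_b 1] mor[of "- 2" 2 0 par_b "- 1"]
      SE6_morphism_b_plus SE6_morphism_b_minus by auto
  moreover have "admits_shift_operator SE6 (shift_param par_c \<epsilon>)"
    using assms mor[of "- 2" 0 0 par_c 1] mor[of "- 2" 2 2 par_c "- 1"]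
      SE6_morphism_c_plus SE6_morphism_c_minus by auto
  moreover have "admits_shift_operator SE6 (shift_param par_g (2 * \<epsilon>))"
    using assms mor[of "- 2" 0 0 par_g 2] mor[of "- 4" 2 2 par_g "- 2"]
      SE6_morphism_g_plus SE6_morphism_g_minus by auto
  ultimately show ?thesis
    using admits_shift_operator_equiv assms by simp
qed

end
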